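(* Let $R$ be a PID. The isomorphism class of a formed space with boundary $(M,\lambda,\partial)$ over $R$ with $M\ne0$ is determined by the equivalence class of its form data $\mathbb{D}(M,\lambda,\partial)$. Moreover, any form data $(n,l,d_1,\dots,d_k,\delta_1,\dots,\delta_{k+1})$ satisfying the relations $$d_1|d_2|\cdots|d_k\quad\text{and}\quad \delta_{i-1}\,|\,\delta_i\,|\,\tfrac{d_i}{d_{i-1}}\delta_{i-1}\ \text{ for }2\le i\le k+1$$ is realized (where for $i=k+1$ one reads $d_{k+1}=0$, so that the second relation is just $\delta_k|\delta_{k+1}$).
   Context: A formed space with boundary over $R$ is a triple $(M,\lambda,\partial)$ with $M$ a finitely generated free $R$-module, $\lambda:M\otimes M\to R$ an alternating bilinear form ($\lambda(v,v)=0$ for all $v$), and $\partial:M\to R$ a linear map. Morphisms are linear maps preserving $\lambda$ and $\partial$. Form data. Let $R$ be a PID and $(M,\lambda,\partial)$ a formed space with boundary with $M\ne0$. Then $(M,\lambda)$ is isomorphic to an orthogonal sum $\bigoplus_{i=1}^k\big(R^2,\begin{pmatrix}0&d_i\\-d_i&0\end{pmatrix}\big)\oplus(R^l,0)$ with $d_1|d_2|\cdots|d_k$ non-zero and unique up to units. The form data of $(M,\lambda,\partial)$ is the tuple $\mathbb{D}(M,\lambda,\partial)=(n,l,d_1,\dots,d_k,\delta_1,\dots,\delta_{k+1})$ where: $n=\mathrm{rk}(M)$ is the rank of $M$; $(l,d_1,\dots,d_k)$ is given by the Smith normal form $\mathrm{diag}(d_1,d_1,\dots,d_k,d_k,0,\dots,0)$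 of $\lambda$, with $l=n-2k\ge0$ zeroes; for $1\le i\le k$, $(\delta_i)=\partial(M_i)$ as ideals of $R$, where $M_i=\{m\in M:\ d_i|\lambda(m,m')\ \forall m'\in M\}$; and $(\delta_{k+1})=\partial(\mathrm{Rad}(M,\lambda))$, where $\mathrm{Rad}(M,\lambda)=\{m\in M:\lambda(m,m')=0\ \forall m'\in M\}$. The $d_i$ and $\delta_i$ are well defined up to units. Two tuples $(n,l,d_1,\dots,d_k,\delta_1,\dots,\delta_{k+1})$ and $(n',l',d'_1,\dots,d'_k,\delta'_1,\dots,\delta'_{k+1})$ are equivalent if $n=n'$, $l=l'$ and there are units $u_i,v_i$ with $d_i=u_id'_i$ and $\delta_i=v_i\delta'_i$. In the realization statement, a form data is a tuple $(n,l,d_1,\dots,d_k,\delta_1,\dots,\delta_{k+1})$ with integers $n\ge1$, $l\ge0$, $k\ge0$ such that $n=2k+l$, non-zero elements $d_1,\dots,d_k\in R$, and elements $\delta_1,\dots,\delta_{k+1}\in R$. "Realized" means equal, up to equivalence, to the form data of some formed space with boundary.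
   Formalization: The realization part additionally assumes that δ_{k+1} = 0 when l = 0; without this it is false, e.g. (2,0,1,1,1) satisfies the relations, but l = 0 forces the radical to be zero and hence δ_2 = 0. *)

theory Defs
  imports Complex_Main "HOL-Library.Function_Algebras"
begin

class pid = idom +
  assumes principal_ideal:
    "0 \<in> I \<Longrightarrow> (\<forall>x\<in>I. \<forall>y\<in>I. x + y \<in> I) \<Longrightarrow> (\<forall>r. \<forall>x\<in>I. r * x \<in> I)
      \<Longrightarrow> \<exists>a. I = range ((*) a)"

section \<open>Formed modules and formed spaces with boundary\<close>

text \<open>
  The underlying module is a submodule \<open>mcarrier\<close> of an ambient module type, so that modules of
  varying rank can live in one type; the form and the boundary only matter on \<open>mcarrier\<close>.
\<close>

record ('r, 'm) formed_module =
  mscale :: "'r \<Rightarrow> 'm \<Rightarrow> 'm"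
  mcarrier :: "'m set"
  form :: "'m \<Rightarrow> 'm \<Rightarrow> 'r"

record ('r, 'm) formed_space = "('r, 'm) formed_module" +
  bdry :: "'m \<Rightarrow> 'r"

definition linear_on ::
    "('r \<Rightarrow> 'm \<Rightarrow> 'm) \<Rightarrow> ('r \<Rightarrow> 'n \<Rightarrow> 'n) \<Rightarrow> 'm set \<Rightarrow> ('m::plus \<Rightarrow> 'n::plus) \<Rightarrow> bool" where
  "linear_on s t M f \<longleftrightarrow>
     (\<forall>x\<in>M. \<forall>y\<in>M. f (x + y) = f x + f y) \<and> (\<forall>a. \<forall>x\<in>M. f (s a x) = t a (f x))"

definition has_rank :: "('r::comm_ring_1, 'm::ab_group_add, 'z) formed_module_scheme \<Rightarrow> nat \<Rightarrow> bool"
  where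
  "has_rank V n \<longleftrightarrow>
     (\<exists>B. finite B \<and> card B = n \<and> \<not> module.dependent (mscale V) B
        \<and> module.span (mscale V) B = mcarrier V)"

definition is_formed_module ::
    "('r::comm_ring_1, 'm::ab_group_add, 'z) formed_module_scheme \<Rightarrow> bool" where
  "is_formed_module V \<longleftrightarrow>
     module (mscale V) \<and> module.subspace (mscale V) (mcarrier V) \<and> (\<exists>n. has_rank V n) \<and>
     (\<forall>y\<in>mcarrier V. linear_on (mscale V) (*) (mcarrier V) (\<lambda>x. form V x y)) \<and>
     (\<forall>x\<in>mcarrier V. linear_on (mscale V) (*) (mcarrier V) (\<lambda>y. form V x y)) \<and>
     (\<forall>x\<in>mcarrier V. form V x x = 0)"

definition is_formed_space :: "('r::comm_ring_1, 'm::ab_group_add) formed_space \<Rightarrow> bool" where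
  "is_formed_space V \<longleftrightarrow>
     is_formed_module V \<and> linear_on (mscale V) (*) (mcarrier V) (bdry V)"

definition is_isometry ::
    "('r, 'm::plus, 'y) formed_module_scheme \<Rightarrow> ('r, 'n::plus, 'z) formed_module_scheme
      \<Rightarrow> ('m \<Rightarrow> 'n) \<Rightarrow> bool" where
  "is_isometry V W f \<longleftrightarrow>
     bij_betw f (mcarrier V) (mcarrier W) \<and>
     linear_on (mscale V) (mscale W) (mcarrier V) f \<and>
     (\<forall>x\<in>mcarrier V. \<forall>y\<in>mcarrier V. form W (f x) (f y) = form V x y)"

definition formed_space_iso ::
    "('r, 'm::plus) formed_space \<Rightarrow> ('r, 'n::plus) formed_space \<Rightarrow> bool" where
  "formed_space_iso V W \<longleftrightarrow>
     (\<exists>f. is_isometry V W f \<and> (\<forall>x\<in>mcarrier V. bdry W (f x) = bdry V x))"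

section \<open>Form data\<close>

text \<open>
  The orthogonal sum of the planes \<open>(R\<^sup>2, (0 d\<^sub>i; -d\<^sub>i 0))\<close>, \<open>i < length ds\<close>, and \<open>(R\<^sup>l, 0)\<close>. Vectors
  of length \<open>2 * length ds + l\<close> are functions on \<open>nat\<close> that vanish from there on; the \<open>i\<close>-th plane has
  the coordinates \<open>2 * i\<close> and \<open>2 * i + 1\<close>.
\<close>

definition standard_form :: "'r::comm_ring_1 list \<Rightarrow> nat \<Rightarrow> ('r, nat \<Rightarrow> 'r) formed_module" where
  "standard_form ds l =
     \<lparr> mscale = (\<lambda>a x i. a * x i),
       mcarrier = {x. \<forall>i \<ge> 2 * length ds + l. x i = 0},
       form = (\<lambda>x y. \<Sum>i<length ds. ds ! i * (x (2 * i) * y (2 * i + 1) - x (2 * i + 1) * y (2 * i))) \<rparr>"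

definition div_submodule :: "('r::comm_ring_1, 'm, 'z) formed_module_scheme \<Rightarrow> 'r \<Rightarrow> 'm set" where
  "div_submodule V d = {m \<in> mcarrier V. \<forall>m'\<in>mcarrier V. d dvd form V m m'}"

definition radical :: "('r::zero, 'm, 'z) formed_module_scheme \<Rightarrow> 'm set" where
  "radical V = {m \<in> mcarrier V. \<forall>m'\<in>mcarrier V. form V m m' = 0}"

text \<open>
  A tuple \<open>(n, l, d\<^sub>1, \<dots>, d\<^sub>k, \<delta>\<^sub>1, \<dots>, \<delta>\<^sub>k\<^sub>+\<^sub>1)\<close>. Here \<open>k\<close> is the length of the list of the \<open>d\<^sub>i\<close>, and list
  indices are shifted by one: \<open>d\<^sub>i = ds ! (i - 1)\<close> and \<open>\<delta>\<^sub>i = \<delta>s ! (i - 1)\<close>.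
\<close>

type_synonym 'r form_data = "nat \<times> nat \<times> 'r list \<times> 'r list"

fun form_data_tuple :: "'r::comm_ring_1 form_data \<Rightarrow> bool" where
  "form_data_tuple (n, l, ds, \<delta>s) \<longleftrightarrow>
     1 \<le> n \<and> n = 2 * length ds + l \<and> 0 \<notin> set ds \<and> length \<delta>s = length ds + 1"

definition divisor_chain :: "'r::comm_ring_1 list \<Rightarrow> bool" where
  "divisor_chain ds \<longleftrightarrow> (\<forall>i. Suc i < length ds \<longrightarrow> ds ! i dvd ds ! Suc i)"

text \<open>
  The form data of \<open>V\<close> is only defined up to units; this predicate holds for each of the choices.
\<close>

fun is_form_data :: "('r::comm_ring_1, 'm::ab_group_add) formed_space \<Rightarrow> 'r form_data \<Rightarrow> bool" where
  "is_form_data V (n, l, ds, \<delta>s) \<longleftrightarrow>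
     form_data_tuple (n, l, ds, \<delta>s) \<and> has_rank V n \<and>
     divisor_chain ds \<and> (\<exists>f. is_isometry V (standard_form ds l) f) \<and>
     (\<forall>i<length ds. range ((*) (\<delta>s ! i)) = bdry V ` div_submodule V (ds ! i)) \<and>
     range ((*) (\<delta>s ! length ds)) = bdry V ` radical V"

fun form_data_equiv :: "'r::comm_ring_1 form_data \<Rightarrow> 'r form_data \<Rightarrow> bool" where
  "form_data_equiv (n, l, ds, \<delta>s) (n', l', ds', \<delta>s') \<longleftrightarrow>
     n = n' \<and> l = l' \<and>
     list_all2 (\<lambda>d d'. \<exists>u. u dvd 1 \<and> d = u * d') ds ds' \<and>
     list_all2 (\<lambda>\<delta> \<delta>'. \<exists>v. v dvd 1 \<and> \<delta> = v * \<delta>') \<delta>s \<delta>s'"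

definition form_data_class :: "('r::comm_ring_1, 'm::ab_group_add) formed_space \<Rightarrow> 'r form_data set"
  where
  "form_data_class V = {D. \<exists>D'. is_form_data V D' \<and> form_data_equiv D D'}"

definition exact_quotient :: "'r::idom \<Rightarrow> 'r \<Rightarrow> 'r" where
  "exact_quotient a b = (THE q. a = q * b)"

lemma exact_quotient_mult: "b \<noteq> 0 \<Longrightarrow> exact_quotient (q * b) b = q"
  unfolding exact_quotient_def by (rule the_equality) auto

text \<open>
  In the last step, \<open>i = k + 1\<close>, the role of \<open>d\<^sub>k\<^sub>+\<^sub>1\<close> is played by \<open>0\<close>.
\<close>

fun form_data_relations :: "'r::idom form_data \<Rightarrow> bool" where
  "form_data_relations (n, l, ds, \<delta>s) \<longleftrightarrow>
     divisor_chain ds \<and>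
     (\<forall>i<length ds. \<delta>s ! i dvd \<delta>s ! Suc i \<and>
        \<delta>s ! Suc i dvd exact_quotient ((ds @ [0]) ! Suc i) (ds ! i) * \<delta>s ! i)"

text \<open>
  If \<open>l = 0\<close> then the radical is zero, so \<open>\<delta>\<^sub>k\<^sub>+\<^sub>1 = 0\<close>. This does not follow from the relations: for
  \<open>(2, 0, 1, 1, 1)\<close> they hold, but that tuple is not the form data of any formed space.
\<close>

lemma form_data_class_last_eq_0:
  fixes V :: "('r::idom, 'm::ab_group_add) formed_space"
  assumes V: "is_formed_space V" and D: "(n, 0, ds, \<delta>s) \<in> form_data_class V"
  shows "\<delta>s ! length ds = 0"
proof -
  obtain es \<epsilon>s where fd: "is_form_data V (n, 0, es, \<epsilon>s)"
    and eqv: "form_data_equiv (n, 0, ds, \<delta>s) (n, 0, es, \<epsilon>s)"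
  proof -
    from D obtain D' where D': "is_form_data V D'" "form_data_equiv (n, 0, ds, \<delta>s) D'"
      unfolding form_data_class_def by blast
    obtain n' l' es \<epsilon>s where "D' = (n', l', es, \<epsilon>s)" by (cases D')
    with D'(2) have "D' = (n, 0, es, \<epsilon>s)" by simp
    with D' that show thesis by blast
  qed
  from fd obtain f where f: "is_isometry V (standard_form es 0) f"
    and nz: "0 \<notin> set es" and len: "length \<epsilon>s = length es + 1"
    and rad: "range ((*) (\<epsilon>s ! length es)) = bdry V ` radical V"
    by auto
  let ?S = "standard_form es 0"
  interpret module "mscale V" using V by (simp add: is_formed_space_def is_formed_module_def)
  have 0: "0 \<in> mcarrier V"
    using V by (simp add: is_formed_space_def is_formed_module_def subspace_def)
  have f0: "f 0 = 0"
  proof -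
    have "f (mscale V 0 0) = mscale ?S 0 (f 0)"
      using f 0 unfolding is_isometry_def linear_on_def by blast
    then show ?thesis by (simp add: standard_form_def fun_eq_iff)
  qed
  have b0: "bdry V 0 = 0"
  proof -
    have "bdry V (mscale V 0 0) = 0 * bdry V 0"
      using V 0 unfolding is_formed_space_def linear_on_def by blast
    then show ?thesis by simp
  qed
  have onto: "f ` mcarrier V = mcarrier ?S" and inj: "inj_on f (mcarrier V)"
    using f by (simp_all add: is_isometry_def bij_betw_def)
  have iso: "form ?S (f x) (f y) = form V x y" if "x \<in> mcarrier V" "y \<in> mcarrier V" for x y
    using f that unfolding is_isometry_def by blast
  have "m = 0" if m: "m \<in> radical V" for m
  proof -
    have mV: "m \<in> mcarrier V" using m by (simp add: radical_def)
    have fm: "f m \<in> mcarrier ?S" unfolding onto[symmetric] using mV by (rule imageI)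
    have orth: "form ?S (f m) y = 0" if y: "y \<in> mcarrier ?S" for y
    proof -
      obtain x where "x \<in> mcarrier V" "y = f x"
        using y unfolding onto[symmetric] by blast
      then show ?thesis using iso[OF mV, of x] m unfolding radical_def by simp
    qed
    have z: "f m (2 * j) = 0 \<and> f m (2 * j + 1) = 0" if j: "j < length es" for j
    proof -
      have dj: "es ! j \<noteq> 0" using nz j by (metis nth_mem)
      have parity: "2 * i \<noteq> Suc (2 * i')" "Suc (2 * i') \<noteq> 2 * i" for i i' :: nat
        by presburger+
      have e1: "form ?S (f m) (\<lambda>i. if i = 2 * j + 1 then 1 else 0) = es ! j * f m (2 * j)"
      proof -
        have "form ?S (f m) (\<lambda>i. if i = 2 * j + 1 then 1 else 0)
            = (\<Sum>i<length es. if i = j then es ! j * f m (2 * j) else 0)"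
          unfolding standard_form_def formed_module.simps
          using parity by (intro sum.cong) auto
        then show ?thesis using j by simp
      qed
      have e2: "form ?S (f m) (\<lambda>i. if i = 2 * j then 1 else 0) = - es ! j * f m (2 * j + 1)"
      proof -
        have "form ?S (f m) (\<lambda>i. if i = 2 * j then 1 else 0)
            = (\<Sum>i<length es. if i = j then - es ! j * f m (2 * j + 1) else 0)"
          unfolding standard_form_def formed_module.simps
          using parity by (intro sum.cong) auto
        then show ?thesis using j by simp
      qed
      have "(\<lambda>i. if i = 2 * j + 1 then 1 else 0) \<in> mcarrier ?S"
        "(\<lambda>i. if i = 2 * j then 1 else 0) \<in> mcarrier ?S"
        using j by (auto simp: standard_form_def)
      then show ?thesis using orth[of "\<lambda>i. if i = 2 * j + 1 then 1 else 0"]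
          orth[of "\<lambda>i. if i = 2 * j then 1 else 0"] unfolding e1 e2 using dj by simp
    qed
    have "f m i = 0" for i
    proof (cases "i < 2 * length es")
      case True
      then have "i div 2 < length es" by simp
      from z[OF this] show ?thesis by (metis even_two_times_div_two odd_two_times_div_two_succ)
    next
      case False
      then show ?thesis using fm by (simp add: standard_form_def)
    qed
    then have "f m = f 0" by (simp add: f0 fun_eq_iff)
    then show ?thesis by (rule inj_onD[OF inj _ mV 0])
  qed
  then have "bdry V ` radical V \<subseteq> {0}" using b0 by auto
  moreover have "\<epsilon>s ! length es * 1 \<in> range ((*) (\<epsilon>s ! length es))" by (rule rangeI)
  ultimately have "\<epsilon>s ! length es = 0" using rad by auto
  moreover have "length ds = length es" "length \<delta>s = length \<epsilon>s"
    using eqv by (auto dest: list_all2_lengthD)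
  ultimately show ?thesis
    using eqv len by (auto simp: list_all2_conv_all_nth)
qed

end

theory Submission
  imports Defs
begin

text \<open>
  A formed module over a PID has a basis \<open>e\<^sub>1, f\<^sub>1, \<dots>, e\<^sub>k, f\<^sub>k, r\<^sub>1, \<dots>, r\<^sub>l\<close> in which the form is an orthogonal
  sum of planes with \<open>\<lambda>(e\<^sub>i, f\<^sub>i) = d\<^sub>i\<close> and of its radical (\<open>alternating_normal_form\<close>). The question is
  then how far isometries can simplify the boundary. The answer (\<open>bdry_normal_form\<close>) is that
  \<open>\<partial>(e\<^sub>i) = \<delta>\<^sub>i\<close>, \<open>\<partial>(r\<^sub>1) = \<delta>\<^sub>k\<^sub>+\<^sub>1\<close> and \<open>\<partial> = 0\<close> on the other basis vectors can always be reached, with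
  \<open>\<delta>\<close>s that satisfy \<open>\<delta>\<^sub>i | \<delta>\<^sub>i\<^sub>+\<^sub>1 | (d\<^sub>i\<^sub>+\<^sub>1 / d\<^sub>i) \<delta>\<^sub>i\<close>.

  Two kinds of isometries suffice. Inside one plane, \<open>SL\<^sub>2\<close> turns the pair of values of \<open>\<partial>\<close> into
  \<open>(g, 0)\<close> with \<open>g\<close> their gcd. A transvection replaces \<open>f\<^sub>1\<close> by \<open>f\<^sub>1 + u\<close> for a vector \<open>u\<close> orthogonal to
  the first plane, and every \<open>y\<close> orthogonal to it by \<open>y + (\<lambda>(u, y) / d\<^sub>1) e\<^sub>1\<close>. It carries \<open>\<partial>(u)\<close> into the
  first plane, and \<open>(\<lambda>(u, y) / d\<^sub>1) g\<close> into the values on the complement. With the complement in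
  normal form and \<open>u = e\<^sub>2\<close>, the first plane then sees a generator \<open>\<delta>\<^sub>1\<close> of \<open>\<partial>(M)\<close>, and the
  complement sees \<open>(d\<^sub>2 / d\<^sub>1) g\<close> besides \<open>\<partial>(e\<^sub>2)\<close>; a combination of the latter two, suitably
  multiplied, is \<open>(d\<^sub>2 / d\<^sub>1) \<delta>\<^sub>1\<close>. This is the relation between \<open>\<delta>\<^sub>1\<close> and \<open>\<delta>\<^sub>2\<close>, and induction on the
  number of planes does the rest.

  Conversely, these relations ensure that \<open>\<partial>(M\<^sub>i) = (\<delta>\<^sub>i)\<close> and \<open>\<partial>(Rad) = (\<delta>\<^sub>k\<^sub>+\<^sub>1)\<close> in a space that
  is in normal form (\<open>normal_bdry_image\<close>). So such spaces realize all tuples that satisfy the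
  relations. Moreover the \<open>\<delta>\<close>s of a normal form can be read off from the form data up to units,
  whence spaces with equivalent form data have normal forms that differ by units only, and
  rescaling the basis identifies these (\<open>iso_rescale\<close>). That equality of the classes of form data
  carries any information at all rests on every space having form data, which is the normal form
  of the alternating form again (\<open>form_data_exists\<close>).
\<close>

section \<open>Divisibility in a principal ideal domain\<close>

lemma pid_bezout:
  fixes a b :: "'r::pid"
  obtains g p q a' b' where "a = a' * g" "b = b' * g" "p * a' + q * b' = 1"
proof -
  let ?I = "{x * a + y * b | x y. True}"
  have I0: "0 \<in> ?I" by (auto intro!: exI[of _ 0])
  have Iadd: "\<forall>u\<in>?I. \<forall>v\<in>?I. u + v \<in> ?I"
  proof (clarify)
    fix x y x' y'
    have "x * a + y * b + (x' * a + y' * b) = (x + x') * a + (y + y') * b"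
      by (simp add: algebra_simps)
    then show "\<exists>xa ya. x * a + y * b + (x' * a + y' * b) = xa * a + ya * b \<and> True" by blast
  qed
  have Imul: "\<forall>r. \<forall>u\<in>?I. r * u \<in> ?I"
  proof (clarify)
    fix r x y
    have "r * (x * a + y * b) = (r * x) * a + (r * y) * b" by (simp add: algebra_simps)
    then show "\<exists>xa ya. r * (x * a + y * b) = xa * a + ya * b \<and> True" by blast
  qed
  obtain g where g: "?I = range ((*) g)" using principal_ideal[OF I0 Iadd Imul] by blast
  have "1 * a + 0 * b \<in> ?I" by blast
  then obtain a' where a: "a = g * a'" unfolding g by auto
  have "0 * a + 1 * b \<in> ?I" by blast
  then obtain b' where b: "b = g * b'" unfolding g by auto
  have "g * 1 \<in> ?I" unfolding g by (rule rangeI)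
  then obtain p q where pq: "g = p * a + q * b" by auto
  show thesis
  proof (cases "g = 0")
    case True
    then show thesis using a b True by (intro that[of 1 0 0 1 0]) simp_all
  next
    case False
    have "g * (p * a' + q * b') = g * 1" using pq unfolding a b by (simp add: algebra_simps)
    then have "p * a' + q * b' = 1" using False by simp
    then show thesis using that[of a' g b' p q] a b by (simp add: mult.commute)
  qed
qed

lemma pid_gcd:
  fixes a b :: "'r::pid"
  shows "\<exists>g p q. g dvd a \<and> g dvd b \<and> g = p * a + q * b"
proof -
  obtain g p q a' b' where ab: "a = a' * g" "b = b' * g" and pq: "p * a' + q * b' = 1"
    by (rule pid_bezout)
  have "p * a + q * b = (p * a' + q * b') * g" by (simp add: ab algebra_simps)
  then have "g = p * a + q * b" using pq by simp
  moreover have "g dvd a" "g dvd b" unfolding ab by simp_all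
  ultimately show ?thesis by blast
qed

text \<open>
  The ascending chain condition: the union of a chain of principal ideals is principal, and its
  generator lies in a member of the chain, where the chain becomes stationary.
\<close>

lemma pid_wf_strict_dvd: "wf {(a, b :: 'r::pid). a dvd b \<and> \<not> b dvd a}"
  unfolding wf_iff_no_infinite_down_chain
proof
  assume "\<exists>f. \<forall>i. (f (Suc i), f i) \<in> {(a, b :: 'r). a dvd b \<and> \<not> b dvd a}"
  then obtain f :: "nat \<Rightarrow> 'r" where f: "f (Suc i) dvd f i" "\<not> f i dvd f (Suc i)" for i by blast
  have mono: "f j dvd f i" if "i \<le> j" for i j
    using that by (induction rule: dec_induct) (auto intro: f(1) dvd_trans)
  let ?I = "{x. \<exists>i. f i dvd x}"
  have "0 \<in> ?I" by simp
  moreover have "\<forall>x\<in>?I. \<forall>y\<in>?I. x + y \<in> ?I"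
  proof (clarify)
    fix x y i j assume ij: "f i dvd x" "f j dvd y"
    have "f (max i j) dvd f i" "f (max i j) dvd f j" by (auto intro: mono)
    then have "f (max i j) dvd x + y" using ij by (blast intro: dvd_add dvd_trans)
    then show "\<exists>k. f k dvd x + y" ..
  qed
  moreover have "\<forall>r. \<forall>x\<in>?I. r * x \<in> ?I" by (auto intro: dvd_mult)
  ultimately obtain c where c: "?I = range ((*) c)" using principal_ideal[of ?I] by blast
  have "c * 1 \<in> ?I" unfolding c by (rule rangeI)
  then obtain i where i: "f i dvd c" by auto
  have "f (Suc i) \<in> ?I" using dvd_refl by blast
  then have "c dvd f (Suc i)" unfolding c by auto
  then show False using i f(2)[of i] by (blast intro: dvd_trans)
qed

section \<open>Coordinate vectors and standard spaces\<close>

definition vec :: "nat \<Rightarrow> (nat \<Rightarrow> 'r::comm_ring_1) set" where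
  "vec n = {x. \<forall>i\<ge>n. x i = 0}"

definition vcons :: "'r \<Rightarrow> (nat \<Rightarrow> 'r) \<Rightarrow> nat \<Rightarrow> 'r" where
  "vcons a x = case_nat a x"

definition vscale :: "'r::times \<Rightarrow> (nat \<Rightarrow> 'r) \<Rightarrow> nat \<Rightarrow> 'r" where
  "vscale a x = (\<lambda>i. a * x i)"

lemma vscale_apply [simp]: "vscale a x i = a * x i"
  by (simp add: vscale_def)

lemma vscale_0 [simp]: "vscale (a :: 'r::mult_zero) 0 = 0"
  by (simp add: fun_eq_iff)

definition vtl :: "(nat \<Rightarrow> 'r) \<Rightarrow> nat \<Rightarrow> 'r" where
  "vtl x = (\<lambda>i. x (Suc i))"

lemma vcons_simps [simp]: "vcons a x 0 = a" "vcons a x (Suc i) = x i"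
  by (simp_all add: vcons_def)

lemma vtl_apply [simp]: "vtl x i = x (Suc i)"
  by (simp add: vtl_def)

lemma vtl_vcons [simp]: "vtl (vcons a x) = x"
  by (simp add: fun_eq_iff)

lemma vtl_linear [simp]: "vtl (x + y) = vtl x + vtl y" "vtl (vscale a x) = vscale a (vtl x)"
  by (simp_all add: fun_eq_iff)

lemma vcons_eq_iff [simp]: "vcons a x = y \<longleftrightarrow> a = y 0 \<and> x = vtl y"
  unfolding fun_eq_iff by (metis not0_implies_Suc vtl_apply vcons_simps)

lemma vcons_linear [simp]: "vcons a x + vcons b y = vcons (a + b) (x + y)"
  "vscale c (vcons a x) = vcons (c * a) (vscale c x)"
  by (auto simp: fun_eq_iff vcons_def split: nat.split)

lemma vec_vcons [simp]: "vcons a x \<in> vec (Suc n) \<longleftrightarrow> x \<in> vec n"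
proof
  assume x: "vcons a x \<in> vec (Suc n)"
  have "vcons a x (Suc i) = 0" if "n \<le> i" for i
    using x that unfolding vec_def by blast
  then show "x \<in> vec n" by (simp add: vec_def)
next
  assume x: "x \<in> vec n"
  have "vcons a x i = 0" if "Suc n \<le> i" for i
    using x that by (cases i) (simp_all add: vec_def)
  then show "vcons a x \<in> vec (Suc n)" by (simp add: vec_def)
qed

lemma vec_vtl [simp]: "vtl x \<in> vec n \<longleftrightarrow> x \<in> vec (Suc n)"
proof -
  have "vcons (x 0) (vtl x) = x" by simp
  then show ?thesis using vec_vcons[of "x 0" "vtl x" n] by metis
qed

lemma vec_closed [simp]:
  "0 \<in> vec n" "x \<in> vec n \<Longrightarrow> y \<in> vec n \<Longrightarrow> x + y \<in> vec n"
  "x \<in> vec n \<Longrightarrow> (vscale a x) \<in> vec n"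
  by (simp_all add: vec_def)

definition pairing :: "'r::comm_ring_1 list \<Rightarrow> (nat \<Rightarrow> 'r) \<Rightarrow> (nat \<Rightarrow> 'r) \<Rightarrow> 'r" where
  "pairing ds x y = (\<Sum>i<length ds. ds ! i * (x (2 * i) * y (2 * i + 1) - x (2 * i + 1) * y (2 * i)))"

lemma pairing_Nil [simp]: "pairing [] x y = 0"
  by (simp add: pairing_def)

lemma pairing_Cons [simp]:
  "pairing (d # ds) x y
    = d * (x 0 * y (Suc 0) - x (Suc 0) * y 0) + pairing ds (vtl (vtl x)) (vtl (vtl y))"
  by (simp add: pairing_def sum.lessThan_Suc_shift del: sum.lessThan_Suc)

lemma pairing_linear:
  "pairing ds (x + x') y = pairing ds x y + pairing ds x' y"
  "pairing ds x (y + y') = pairing ds x y + pairing ds x y'"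
  "pairing ds (vscale a x) y = a * pairing ds x y"
  "pairing ds x (vscale a y) = a * pairing ds x y"
  by (simp_all add: pairing_def sum.distrib[symmetric] sum_distrib_left algebra_simps)

lemma pairing_self [simp]: "pairing ds x x = 0"
  by (simp add: pairing_def mult.commute)

lemma pairing_swap: "pairing ds x y = - pairing ds y x"
  by (simp add: pairing_def sum_negf[symmetric] algebra_simps)

text \<open>
  The boundary of the normal form: \<open>\<delta>\<^sub>i\<close> is its value on the first basis vector of the \<open>i\<close>-th plane,
  and the last \<open>\<delta>\<close> its value on the first basis vector of the radical. If the radical is zero, the
  coordinate that belongs to the last \<open>\<delta>\<close> vanishes on the whole module.
\<close>

definition normal_bdry :: "'r::comm_ring_1 list \<Rightarrow> (nat \<Rightarrow> 'r) \<Rightarrow> 'r" where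
  "normal_bdry \<delta>s x = (\<Sum>i<length \<delta>s. \<delta>s ! i * x (2 * i))"

lemma normal_bdry_Nil [simp]: "normal_bdry [] x = 0"
  by (simp add: normal_bdry_def)

lemma normal_bdry_Cons [simp]: "normal_bdry (\<delta> # \<delta>s) x = \<delta> * x 0 + normal_bdry \<delta>s (vtl (vtl x))"
  by (simp add: normal_bdry_def sum.lessThan_Suc_shift del: sum.lessThan_Suc)

definition standard_space ::
    "'r::comm_ring_1 list \<Rightarrow> nat \<Rightarrow> ((nat \<Rightarrow> 'r) \<Rightarrow> 'r) \<Rightarrow> ('r, nat \<Rightarrow> 'r) formed_space" where
  "standard_space ds l \<beta> =
     \<lparr> mscale = vscale, mcarrier = vec (2 * length ds + l), form = pairing ds, bdry = \<beta> \<rparr>"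

lemma standard_space_sel [simp]:
  "mscale (standard_space ds l \<beta>) = vscale"
  "mcarrier (standard_space ds l \<beta>) = vec (2 * length ds + l)"
  "form (standard_space ds l \<beta>) = pairing ds"
  "bdry (standard_space ds l \<beta>) = \<beta>"
  by (simp_all add: standard_space_def)

lemma standard_form_sel [simp]:
  "mscale (standard_form ds l) = vscale"
  "mcarrier (standard_form ds l) = vec (2 * length ds + l)"
  "form (standard_form ds l) = pairing ds"
  by (simp_all add: standard_form_def vec_def pairing_def vscale_def fun_eq_iff)

section \<open>Isomorphisms between standard spaces\<close>

lemma formed_space_iso_trans [trans]:
  assumes "formed_space_iso U V" "formed_space_iso V W"
  shows "formed_space_iso U W"
proof -
  from assms obtain f g where f: "is_isometry U V f" "\<forall>x\<in>mcarrier U. bdry V (f x) = bdry U x"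
    and g: "is_isometry V W g" "\<forall>x\<in>mcarrier V. bdry W (g x) = bdry V x"
    unfolding formed_space_iso_def by blast
  have fV: "f x \<in> mcarrier V" if "x \<in> mcarrier U" for x
    using f that by (auto simp: is_isometry_def bij_betw_def)
  have "is_isometry U W (g \<circ> f)"
    using f g fV unfolding is_isometry_def linear_on_def
    by (auto intro: bij_betw_trans)
  then show ?thesis
    using f g fV unfolding formed_space_iso_def by auto
qed

lemma is_isometry_inv:
  assumes V: "is_formed_module V" and f: "is_isometry V W f"
  shows "is_isometry W V (inv_into (mcarrier V) f)"
proof -
  interpret module "mscale V" using V by (simp add: is_formed_module_def)
  let ?g = "inv_into (mcarrier V) f"
  have sub: "subspace (mcarrier V)" using V by (simp add: is_formed_module_def)
  have inj: "inj_on f (mcarrier V)" and im: "f ` mcarrier V = mcarrier W"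
    using f by (auto simp: is_isometry_def bij_betw_def)
  have gV: "?g y \<in> mcarrier V" and fg: "f (?g y) = y" if "y \<in> mcarrier W" for y
    using that im by (auto intro: inv_into_into f_inv_into_f)
  have gf: "?g (f x) = x" if "x \<in> mcarrier V" for x using inj that by simp
  have "?g (x + y) = ?g x + ?g y" if "x \<in> mcarrier W" "y \<in> mcarrier W" for x y
  proof -
    have "f (?g x + ?g y) = x + y"
      using f that by (simp add: is_isometry_def linear_on_def gV fg)
    then show ?thesis using gf[of "?g x + ?g y"] subspace_add[OF sub] gV that by simp
  qed
  moreover have "?g (mscale W a x) = mscale V a (?g x)" if "x \<in> mcarrier W" for x a
  proof -
    have "f (mscale V a (?g x)) = mscale W a x"
      using f that by (simp add: is_isometry_def linear_on_def gV fg)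
    then show ?thesis using gf[of "mscale V a (?g x)"] subspace_scale[OF sub] gV that by simp
  qed
  moreover have "form V (?g x) (?g y) = form W x y" if "x \<in> mcarrier W" "y \<in> mcarrier W" for x y
    using f that gV fg unfolding is_isometry_def by metis
  moreover have "bij_betw ?g (mcarrier W) (mcarrier V)"
    using f bij_betw_inv_into by (auto simp: is_isometry_def)
  ultimately show ?thesis by (auto simp: is_isometry_def linear_on_def)
qed

lemma formed_space_iso_sym:
  assumes V: "is_formed_space V" and iso: "formed_space_iso V W"
  shows "formed_space_iso W V"
proof -
  obtain f where f: "is_isometry V W f" "\<forall>x\<in>mcarrier V. bdry W (f x) = bdry V x"
    using iso by (auto simp: formed_space_iso_def)
  let ?g = "inv_into (mcarrier V) f"
  have im: "f ` mcarrier V = mcarrier W"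
    using f by (auto simp: is_isometry_def bij_betw_def)
  have "bdry V (?g y) = bdry W y" if "y \<in> mcarrier W" for y
    using f(2) im that by (metis f_inv_into_f inv_into_into)
  moreover have "is_isometry W V ?g"
    using V f(1) is_isometry_inv by (auto simp: is_formed_space_def)
  ultimately show ?thesis by (auto simp: formed_space_iso_def)
qed

lemma formed_space_iso_standardI:
  fixes T T' :: "(nat \<Rightarrow> 'r::comm_ring_1) \<Rightarrow> nat \<Rightarrow> 'r"
  assumes "\<And>x. x \<in> vec (2 * length ds + l) \<Longrightarrow> T x \<in> vec (2 * length ds' + l') \<and> T' (T x) = x"
    and "\<And>y. y \<in> vec (2 * length ds' + l') \<Longrightarrow> T' y \<in> vec (2 * length ds + l) \<and> T (T' y) = y"
    and "\<And>x y. x \<in> vec (2 * length ds + l) \<Longrightarrow> y \<in> vec (2 * length ds + l) \<Longrightarrow> T (x + y) = T x + T y"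
    and "\<And>a x. x \<in> vec (2 * length ds + l) \<Longrightarrow> T (vscale a x) = vscale a (T x)"
    and "\<And>x y. x \<in> vec (2 * length ds + l) \<Longrightarrow> y \<in> vec (2 * length ds + l) \<Longrightarrow> pairing ds' (T x) (T y) = pairing ds x y"
    and "\<And>x. x \<in> vec (2 * length ds + l) \<Longrightarrow> \<beta>' (T x) = \<beta> x"
  shows "formed_space_iso (standard_space ds l \<beta>) (standard_space ds' l' \<beta>')"
proof -
  have "bij_betw T (vec (2 * length ds + l)) (vec (2 * length ds' + l'))"
    by (rule bij_betw_byWitness[where f' = T']) (use assms(1,2) in auto)
  then show ?thesis
    using assms unfolding formed_space_iso_def is_isometry_def linear_on_def by auto
qed

lemma formed_space_iso_refl: "formed_space_iso V V"
  unfolding formed_space_iso_def is_isometry_def linear_on_def by (auto intro!: exI[of _ id])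

lemma iso_bdry_cong:
  assumes "\<And>x. x \<in> vec (2 * length ds + l) \<Longrightarrow> \<beta> x = \<beta>' x"
  shows "formed_space_iso (standard_space ds l \<beta>) (standard_space ds l \<beta>')"
  by (rule formed_space_iso_standardI[where T = id and T' = id]) (use assms in auto)

text \<open>
  A \<open>2 \<times> 2\<close> matrix multiplies the form of the first plane by its determinant. With determinant \<open>1\<close>
  this is an isometry that mixes the two boundary values of the plane; with other units it
  rescales the elementary divisor.
\<close>

lemma iso_plane:
  fixes d :: "'r::comm_ring_1"
  assumes iso: "formed_space_iso (standard_space ds l \<beta>) (standard_space ds' l' \<beta>')"
    and d: "d = d' * (p * s - q * r)" and w: "(p * s - q * r) * w = 1"
    and a: "a = a' * p + b' * r" and b: "b = a' * q + b' * s"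
  shows "formed_space_iso
     (standard_space (d # ds) l (\<lambda>x. a * x 0 + b * x (Suc 0) + \<beta> (vtl (vtl x))))
     (standard_space (d' # ds') l' (\<lambda>x. a' * x 0 + b' * x (Suc 0) + \<beta>' (vtl (vtl x))))"
proof -
  let ?C = "vec (2 * length ds + l) :: (nat \<Rightarrow> 'r) set"
    and ?C' = "vec (2 * length ds' + l') :: (nat \<Rightarrow> 'r) set"
  obtain T where bij: "bij_betw T ?C ?C'"
    and T_add: "\<And>x y. x \<in> ?C \<Longrightarrow> y \<in> ?C \<Longrightarrow> T (x + y) = T x + T y"
    and T_scale: "\<And>c x. x \<in> ?C \<Longrightarrow> T (vscale c x) = vscale c (T x)"
    and T_form: "\<And>x y. x \<in> ?C \<Longrightarrow> y \<in> ?C \<Longrightarrow> pairing ds' (T x) (T y) = pairing ds x y"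
    and T_bdry: "\<And>x. x \<in> ?C \<Longrightarrow> \<beta>' (T x) = \<beta> x"
    using iso unfolding formed_space_iso_def is_isometry_def linear_on_def by auto
  define T' where "T' = inv_into ?C T"
  have T1: "T x \<in> ?C'" "T' (T x) = x" if "x \<in> ?C" for x
    using bij that by (auto simp: bij_betw_def T'_def)
  have T2: "T' y \<in> ?C" "T (T' y) = y" if "y \<in> ?C'" for y
    using bij that by (auto simp: bij_betw_def T'_def inv_into_into f_inv_into_f)
  have w1: "w * (p * (s * x)) = x + w * (q * (r * x))" for x
  proof -
    have "w * (p * (s * x)) - w * (q * (r * x)) = ((p * s - q * r) * w) * x"
      by (simp add: algebra_simps)
    then have "w * (p * (s * x)) - w * (q * (r * x)) = x" unfolding w by simp
    then show ?thesis by (simp add: diff_eq_eq)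
  qed
  have inv: "w * (s * (p * x + q * y) - q * (r * x + s * y)) = x"
    "w * (p * (r * x + s * y) - r * (p * x + q * y)) = y"
    "p * (w * (s * x - q * y)) + q * (w * (p * y - r * x)) = x"
    "r * (w * (s * x - q * y)) + s * (w * (p * y - r * x)) = y" for x y
    using w1[of x] w1[of y] by (simp_all add: algebra_simps)
  show ?thesis
  proof (rule formed_space_iso_standardI
      [where T = "\<lambda>x. vcons (p * x 0 + q * x 1) (vcons (r * x 0 + s * x 1) (T (vtl (vtl x))))"
        and T' = "\<lambda>x. vcons (w * (s * x 0 - q * x 1)) (vcons (w * (p * x 1 - r * x 0)) (T' (vtl (vtl x))))"],
      goal_cases)
    case (1 x) then show ?case by (simp add: T1 inv)
  next
    case (2 x) then show ?case by (simp add: T2 inv)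
  next
    case (3 x y) then show ?case by (simp add: T_add algebra_simps)
  next
    case (4 a x) then show ?case by (simp add: T_scale algebra_simps)
  next
    case (5 x y) then show ?case by (simp add: T_form d algebra_simps)
  next
    case (6 x) then show ?case by (simp add: T_bdry a b algebra_simps)
  qed
qed

definition functional :: "nat \<Rightarrow> ((nat \<Rightarrow> 'r::comm_ring_1) \<Rightarrow> 'r) \<Rightarrow> bool" where
  "functional n \<beta> \<longleftrightarrow> linear_on vscale (*) (vec n) \<beta>"

lemma functionalD:
  assumes "functional n \<beta>"
  shows "x \<in> vec n \<Longrightarrow> y \<in> vec n \<Longrightarrow> \<beta> (x + y) = \<beta> x + \<beta> y"
    and "x \<in> vec n \<Longrightarrow> \<beta> (vscale a x) = a * \<beta> x"
    and "\<beta> 0 = 0"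
proof -
  show add: "x \<in> vec n \<Longrightarrow> y \<in> vec n \<Longrightarrow> \<beta> (x + y) = \<beta> x + \<beta> y" for x y
    using assms by (simp add: functional_def linear_on_def)
  show "x \<in> vec n \<Longrightarrow> \<beta> (vscale a x) = a * \<beta> x"
    using assms by (simp add: functional_def linear_on_def)
  show "\<beta> 0 = 0" using add[of 0 0] by simp
qed

text \<open>
  With \<open>e, f\<close> the basis of the first plane, the new basis consists of \<open>e\<close>, \<open>f + u\<close> and the
  \<open>y + \<phi>(y) e\<close> for \<open>y\<close> in the complement; orthogonality persists because \<open>d \<phi>(y) = \<lambda>(u, y)\<close>.
  The value \<open>d = 0\<close> is allowed: the plane then lies in the radical, \<open>u\<close> has to be in the radical of the
  complement, and \<open>\<phi>\<close> can be any functional that vanishes on \<open>u\<close>.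
\<close>

lemma iso_transvection:
  fixes d :: "'r::comm_ring_1"
  assumes \<beta>: "functional (2 * length ds + l) \<beta>"
    and \<phi>: "functional (2 * length ds + l) \<phi>"
    and u: "u \<in> vec (2 * length ds + l)" "\<phi> u = 0"
    and \<phi>u: "\<And>x. x \<in> vec (2 * length ds + l) \<Longrightarrow> d * \<phi> x = pairing ds u x"
  shows "formed_space_iso
     (standard_space (d # ds) l (\<lambda>x. a * x 0 + \<beta> (vtl (vtl x))))
     (standard_space (d # ds) l
       (\<lambda>x. a * x 0 + \<beta> u * x (Suc 0) + (a * \<phi> (vtl (vtl x)) + \<beta> (vtl (vtl x)))))"
proof -
  let ?n = "2 * length ds + l"
  have sub: "x + vscale c u \<in> vec ?n" if "x \<in> vec ?n" for x c
    using that u by simp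
  have \<phi>_shift: "\<phi> (x + vscale c u) = \<phi> x" if "x \<in> vec ?n" for x c
    using that u by (simp add: functionalD[OF \<phi>])
  have form_shift: "d * (x0 - \<phi> x) * z1 - d * x1 * (z0 - \<phi> z)
      + pairing ds (x + vscale (- x1) u) (z + vscale (- z1) u)
      = d * x0 * z1 - d * x1 * z0 + pairing ds x z" if "x \<in> vec ?n" "z \<in> vec ?n" for x z x0 x1 z0 z1
  proof -
    have "d * (x0 - \<phi> x) * z1 - d * x1 * (z0 - \<phi> z)
        = d * x0 * z1 - d * x1 * z0 - (d * \<phi> x) * z1 + x1 * (d * \<phi> z)"
      by (simp add: algebra_simps)
    then show ?thesis
      unfolding pairing_linear pairing_self
      using \<phi>u[of x] \<phi>u[of z] that pairing_swap[of ds x u] by (simp add: mult.commute)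
  qed
  have cancel: "y + vscale (- c) u + vscale c u = y" "y + vscale c u + vscale (- c) u = y" for y c
    by (simp_all add: fun_eq_iff)
  show ?thesis
  proof (rule formed_space_iso_standardI
      [where T = "\<lambda>x. vcons (x 0 - \<phi> (vtl (vtl x)))
          (vcons (x (Suc 0)) (vtl (vtl x) + vscale (- x (Suc 0)) u))"
        and T' = "\<lambda>x. vcons (x 0 + \<phi> (vtl (vtl x)))
          (vcons (x (Suc 0)) (vtl (vtl x) + vscale (x (Suc 0)) u))"],
      goal_cases)
    case (1 x)
    then have x: "vtl (vtl x) \<in> vec ?n" by simp
    then show ?case using sub[OF x, of "- x (Suc 0)"] \<phi>_shift[OF x, of "- x (Suc 0)"] by (simp add: cancel)
  next
    case (2 x)
    then have x: "vtl (vtl x) \<in> vec ?n" by simp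
    then show ?case using sub[OF x, of "x (Suc 0)"] \<phi>_shift[OF x, of "x (Suc 0)"] by (simp add: cancel)
  next
    case (3 x y)
    then have "\<phi> (vtl (vtl x) + vtl (vtl y)) = \<phi> (vtl (vtl x)) + \<phi> (vtl (vtl y))"
      by (intro functionalD[OF \<phi>]) simp_all
    moreover have "vscale (- p - q) u = vscale (- p) u + vscale (- q) u" for p q :: 'r
      by (simp add: fun_eq_iff algebra_simps)
    ultimately show ?case by (simp add: algebra_simps)
  next
    case (4 c x)
    then have "\<phi> (vscale c (vtl (vtl x))) = c * \<phi> (vtl (vtl x))"
      by (intro functionalD[OF \<phi>]) simp
    moreover have "vscale c (y + vscale (- p) u) = vscale c y + vscale (- (c * p)) u" for p y
      by (simp add: fun_eq_iff algebra_simps)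
    ultimately show ?case by (simp add: algebra_simps)
  next
    case (5 x y)
    then have x: "vtl (vtl x) \<in> vec ?n" "vtl (vtl y) \<in> vec ?n" by simp_all
    show ?case using form_shift[OF x, of "x 0" "y (Suc 0)" "x (Suc 0)" "y 0"] by (simp add: algebra_simps)
  next
    case (6 x)
    then have x: "vtl (vtl x) \<in> vec ?n" by simp
    then have "vscale (- x (Suc 0)) u \<in> vec ?n" using u vec_closed(3) by blast
    then show ?case using x u \<phi>_shift[OF x, of "- x (Suc 0)"]
      by (simp add: functionalD(1)[OF \<beta>] functionalD(2)[OF \<beta>, of _ "- x (Suc 0)", simplified] algebra_simps)
  qed
qed

section \<open>The normal form of the boundary\<close>

lemma functional_vcons:
  assumes \<beta>: "functional (Suc n) \<beta>"
  obtains a \<beta>' where "functional n \<beta>'" "\<And>x. x \<in> vec (Suc n) \<Longrightarrow> \<beta> x = a * x 0 + \<beta>' (vtl x)"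
proof
  show "functional n (\<lambda>y. \<beta> (vcons 0 y))"
    unfolding functional_def linear_on_def
  proof (intro conjI ballI allI)
    fix x y :: "nat \<Rightarrow> 'a" assume "x \<in> vec n" "y \<in> vec n"
    then show "\<beta> (vcons 0 (x + y)) = \<beta> (vcons 0 x) + \<beta> (vcons 0 y)"
      using functionalD(1)[OF \<beta>, of "vcons 0 x" "vcons 0 y"] by simp
  next
    fix a and x :: "nat \<Rightarrow> 'a" assume "x \<in> vec n"
    then show "\<beta> (vcons 0 (vscale a x)) = a * \<beta> (vcons 0 x)"
      using functionalD(2)[OF \<beta>, of "vcons 0 x" a] by simp
  qed
  fix x :: "nat \<Rightarrow> 'a" assume x: "x \<in> vec (Suc n)"
  have "vcons (x 0) (vscale (x 0) 0) + vcons 0 (vtl x) = x"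
    by simp
  then have "vscale (x 0) (vcons 1 0) + vcons 0 (vtl x) = x" by simp
  then have "\<beta> x = \<beta> (vscale (x 0) (vcons 1 0) + vcons 0 (vtl x))" by (simp only:)
  also have "\<beta> (vscale (x 0) (vcons 1 0) + vcons 0 (vtl x)) = x 0 * \<beta> (vcons 1 0) + \<beta> (vcons 0 (vtl x))"
    using x by (simp only: functionalD[OF \<beta>] vec_vcons vec_closed vec_vtl)
  finally show "\<beta> x = \<beta> (vcons 1 0) * x 0 + \<beta> (vcons 0 (vtl x))" by (simp add: mult.commute)
qed

text \<open>
  The first plane collects the boundary value of \<open>u\<close>: make the boundary \<open>(g, 0)\<close> on it by a matrix in
  \<open>SL\<^sub>2\<close>, bring in \<open>\<partial>(u)\<close> as the second value by a transvection, and pass to the gcd \<open>h\<close> of \<open>g\<close> and \<open>\<partial>(u)\<close> by another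
  matrix. The price is the term \<open>g \<phi>\<close> on the complement, which is what links consecutive \<open>\<delta>\<close>s.
\<close>

lemma iso_gather:
  fixes a b d :: "'r::pid"
  assumes iso: "formed_space_iso (standard_space ds l \<beta>) (standard_space ds l \<beta>')"
    and \<beta>': "functional (2 * length ds + l) \<beta>'" and \<phi>: "functional (2 * length ds + l) \<phi>"
    and u: "u \<in> vec (2 * length ds + l)" "\<phi> u = 0"
    and \<phi>u: "\<And>x. x \<in> vec (2 * length ds + l) \<Longrightarrow> d * \<phi> x = pairing ds u x"
  obtains h g s t where "h dvd g" "h dvd \<beta>' u" "h = s * g + t * \<beta>' u"
    "formed_space_iso
      (standard_space (d # ds) l (\<lambda>x. a * x 0 + b * x (Suc 0) + \<beta> (vtl (vtl x))))
      (standard_space (d # ds) l (\<lambda>x. h * x 0 + (g * \<phi> (vtl (vtl x)) + \<beta>' (vtl (vtl x)))))"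
proof -
  have plane: "formed_space_iso
      (standard_space (d # ds) l (\<lambda>x. a1 * g * x 0 + b1 * g * x (Suc 0) + \<gamma> (vtl (vtl x))))
      (standard_space (d # ds) l (\<lambda>x. g * x 0 + \<gamma>' (vtl (vtl x))))"
    if "p * a1 + q * b1 = 1" "formed_space_iso (standard_space ds l \<gamma>) (standard_space ds l \<gamma>')"
    for a1 b1 g p q \<gamma> \<gamma>'
    using iso_plane[OF that(2), of d d a1 p b1 "- q" 1 "a1 * g" g 0 "b1 * g"] that(1)
    by (simp add: mult.commute)
  obtain g p q a1 b1 where ab: "a = a1 * g" "b = b1 * g" and pq: "p * a1 + q * b1 = 1"
    by (rule pid_bezout)
  obtain h s t g1 c1 where gc: "g = g1 * h" "\<beta>' u = c1 * h" and st: "s * g1 + t * c1 = 1"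
    by (rule pid_bezout)
  let ?S = "standard_space (d # ds) l"
  have "formed_space_iso (?S (\<lambda>x. a * x 0 + b * x (Suc 0) + \<beta> (vtl (vtl x))))
      (?S (\<lambda>x. g * x 0 + \<beta>' (vtl (vtl x))))"
    using plane[OF pq iso, of g] by (simp add: ab)
  also have "formed_space_iso \<dots> (?S (\<lambda>x. g * x 0 + \<beta>' u * x (Suc 0)
      + (g * \<phi> (vtl (vtl x)) + \<beta>' (vtl (vtl x)))))"
    by (rule iso_transvection[OF \<beta>' \<phi> u \<phi>u])
  also have "formed_space_iso \<dots> (?S (\<lambda>x. h * x 0 + (g * \<phi> (vtl (vtl x)) + \<beta>' (vtl (vtl x)))))"
    using plane[OF st formed_space_iso_refl, of h "\<lambda>x. g * \<phi> x + \<beta>' x"] by (simp add: gc)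
  finally have *: "formed_space_iso (?S (\<lambda>x. a * x 0 + b * x (Suc 0) + \<beta> (vtl (vtl x))))
      (?S (\<lambda>x. h * x 0 + (g * \<phi> (vtl (vtl x)) + \<beta>' (vtl (vtl x)))))" .
  have "h = h * (s * g1 + t * c1)" by (simp add: st)
  also have "\<dots> = s * g + t * \<beta>' u" by (simp add: gc algebra_simps)
  finally have h: "h = s * g + t * \<beta>' u" .
  have "h dvd g" "h dvd \<beta>' u" unfolding gc by simp_all
  then show thesis by (rule that[OF _ _ h *])
qed

text \<open>
  The first unit vector, or zero in rank \<open>0\<close>, so that it is a vector of length \<open>n\<close> in all cases.
\<close>

definition first_unit :: "nat \<Rightarrow> nat \<Rightarrow> 'r::comm_ring_1" where
  "first_unit n = (if n = 0 then 0 else vcons 1 0)"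

lemma vec_0: "x \<in> vec 0 \<Longrightarrow> x = 0"
  by (simp add: vec_def fun_eq_iff)

lemma first_unit_vec [simp]: "first_unit n \<in> vec n"
  by (cases n) (simp_all add: first_unit_def)

lemma vtl_0 [simp]: "vtl 0 = 0"
  by (simp add: fun_eq_iff)

lemma pairing_0 [simp]: "pairing ds 0 x = 0"
  by (simp add: pairing_def)

lemma normal_bdry_0 [simp]: "normal_bdry \<delta>s 0 = 0"
  by (simp add: normal_bdry_def)

lemma normal_bdry_linear:
  "normal_bdry \<delta>s (x + y) = normal_bdry \<delta>s x + normal_bdry \<delta>s y"
  "normal_bdry \<delta>s (vscale a x) = a * normal_bdry \<delta>s x"
  by (simp_all add: normal_bdry_def sum.distrib[symmetric] sum_distrib_left algebra_simps)

lemma normal_bdry_functional: "functional n (normal_bdry \<delta>s)"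
  by (simp add: functional_def linear_on_def normal_bdry_linear)

text \<open>
  Two basis vectors of a space with zero form span a plane with elementary divisor \<open>0\<close>, so the moves
  for planes apply: collect the boundary value \<open>\<delta>\<close> of the remaining vectors, which leaves a divisor
  \<open>h\<close> of \<open>\<delta>\<close> on the plane, and then remove \<open>\<delta>\<close> by a transvection with \<open>u = 0\<close>.
\<close>

lemma isotropic_normal_form:
  fixes \<beta> :: "(nat \<Rightarrow> 'r::pid) \<Rightarrow> 'r"
  assumes "functional l \<beta>"
  shows "\<exists>\<delta>. (l = 0 \<longrightarrow> \<delta> = 0) \<and>
    formed_space_iso (standard_space [] l \<beta>) (standard_space [] l (normal_bdry [\<delta>]))"
  using assms
proof (induction l arbitrary: \<beta> rule: induct_nat_012)
  case 0
  have "\<beta> x = 0" if "x \<in> vec 0" for x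
    using functionalD(3)[OF 0] vec_0[OF that] by (simp add: zero_fun_def)
  then show ?case
    by (intro exI[of _ 0] conjI iso_bdry_cong) simp_all
next
  case 1
  then obtain a \<beta>' where "functional 0 \<beta>'" "\<And>x. x \<in> vec 1 \<Longrightarrow> \<beta> x = a * x 0 + \<beta>' (vtl x)"
    using functional_vcons[of 0 \<beta>] by (metis One_nat_def)
  moreover have "\<beta>' (vtl x) = 0" if "x \<in> vec 1" for x
  proof -
    have "vtl x \<in> vec 0" using that by simp
    then have "vtl x = 0" by (rule vec_0)
    then show ?thesis using functionalD(3) \<open>functional 0 \<beta>'\<close> by simp
  qed
  ultimately show ?case
    by (intro exI[of _ a] conjI iso_bdry_cong) simp_all
next
  case (ge2 l)
  have zero: "standard_space [0] l \<gamma> = standard_space [] (Suc (Suc l)) \<gamma>" for \<gamma> :: "(nat \<Rightarrow> 'r) \<Rightarrow> 'r"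
    by (simp add: standard_space_def fun_eq_iff)
  obtain a \<beta>1 where \<beta>1: "functional (Suc l) \<beta>1"
    "\<And>x. x \<in> vec (Suc (Suc l)) \<Longrightarrow> \<beta> x = a * x 0 + \<beta>1 (vtl x)"
    using functional_vcons[OF ge2.prems] by metis
  obtain b \<beta>2 where \<beta>2: "functional l \<beta>2"
    "\<And>x. x \<in> vec (Suc l) \<Longrightarrow> \<beta>1 x = b * x 0 + \<beta>2 (vtl x)"
    using functional_vcons[OF \<beta>1(1)] by metis
  obtain \<delta> where \<delta>: "l = 0 \<longrightarrow> \<delta> = 0"
    and iso: "formed_space_iso (standard_space [] l \<beta>2) (standard_space [] l (normal_bdry [\<delta>]))"
    using ge2.IH(1)[OF \<beta>2(1)] by blast
  have zero_fun: "functional (2 * length [] + l) (\<lambda>x. 0 :: 'r)"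
    by (simp add: functional_def linear_on_def)
  have \<delta>u: "normal_bdry [\<delta>] (first_unit l) = \<delta>" using \<delta> by (simp add: first_unit_def)
  obtain h g s t where h: "h dvd \<delta>" and iso2: "formed_space_iso
      (standard_space [0] l (\<lambda>x. a * x 0 + b * x (Suc 0) + \<beta>2 (vtl (vtl x))))
      (standard_space [0] l (\<lambda>x. h * x 0 + (g * 0 + normal_bdry [\<delta>] (vtl (vtl x)))))"
    by (rule iso_gather[OF iso normal_bdry_functional zero_fun, of "first_unit l" 0 a b])
       (auto simp: \<delta>u simp del: normal_bdry_Cons)
  obtain c where c: "\<delta> = h * c" using h by (auto elim: dvdE)
  have "functional (2 * length [] + l) (\<lambda>x. - c * x 0)"
    by (simp add: functional_def linear_on_def algebra_simps)
  from iso_transvection[OF normal_bdry_functional this, of 0 0 h "[\<delta>]"]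
  have "formed_space_iso
      (standard_space [0] l (\<lambda>x. h * x 0 + normal_bdry [\<delta>] (vtl (vtl x))))
      (standard_space [0] l (\<lambda>x. h * x 0))"
    by (simp add: c algebra_simps)
  moreover have "normal_bdry [h] = (\<lambda>x. h * x 0)" by (simp add: fun_eq_iff)
  ultimately have iso3: "formed_space_iso
      (standard_space [0] l (\<lambda>x. h * x 0 + normal_bdry [\<delta>] (vtl (vtl x))))
      (standard_space [0] l (normal_bdry [h]))"
    by simp
  have "formed_space_iso (standard_space [] (Suc (Suc l)) \<beta>)
      (standard_space [0] l (\<lambda>x. a * x 0 + b * x (Suc 0) + \<beta>2 (vtl (vtl x))))"
    unfolding zero by (rule iso_bdry_cong) (simp add: \<beta>1 \<beta>2)
  from formed_space_iso_trans[OF this formed_space_iso_trans[OF iso2]] iso3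
  show ?case by (intro exI[of _ h]) (simp add: zero del: normal_bdry_Cons)
qed

text \<open>
  The second divisibility is \<open>\<delta>\<^sub>i\<^sub>+\<^sub>1 | (d\<^sub>i\<^sub>+\<^sub>1 / d\<^sub>i) \<delta>\<^sub>i\<close> with the denominator cleared, so that it can be chained
  and cancelled. The last conjunct reflects that \<open>\<partial>\<close> vanishes on a zero radical.
\<close>

definition bdry_chain :: "'r::comm_ring_1 list \<Rightarrow> nat \<Rightarrow> 'r list \<Rightarrow> bool" where
  "bdry_chain ds l \<delta>s \<longleftrightarrow>
     length \<delta>s = Suc (length ds) \<and>
     (\<forall>i<length ds. \<delta>s ! i dvd \<delta>s ! Suc i \<and> ds ! i * \<delta>s ! Suc i dvd (ds @ [0]) ! Suc i * \<delta>s ! i) \<and>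
     (l = 0 \<longrightarrow> \<delta>s ! length ds = 0)"

lemma bdry_chain_Cons:
  "bdry_chain (d # ds) l (\<delta> # \<delta>s) \<longleftrightarrow>
     \<delta> dvd \<delta>s ! 0 \<and> d * \<delta>s ! 0 dvd (ds @ [0]) ! 0 * \<delta> \<and> bdry_chain ds l \<delta>s"
  by (auto simp: bdry_chain_def All_less_Suc2 less_Suc_eq_0_disj)

lemma bdry_chain_mono:
  assumes "bdry_chain ds l \<delta>s" "i \<le> j" "j \<le> length ds"
  shows "\<delta>s ! i dvd \<delta>s ! j"
  using assms(2,3)
proof (induction rule: dec_induct)
  case (step n)
  then show ?case using assms(1) by (auto simp: bdry_chain_def intro: dvd_trans)
qed simp

lemma dvd_normal_bdry:
  assumes "bdry_chain ds l \<delta>s" "c dvd \<delta>s ! 0"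
  shows "c dvd normal_bdry \<delta>s x"
  unfolding normal_bdry_def
proof (intro dvd_sum dvd_mult2)
  fix i assume "i \<in> {..<length \<delta>s}"
  then show "c dvd \<delta>s ! i"
    using bdry_chain_mono[OF assms(1), of 0 i] assms by (auto simp: bdry_chain_def intro: dvd_trans)
qed

lemma normal_bdry_first_unit:
  assumes "bdry_chain ds l \<delta>s"
  shows "normal_bdry \<delta>s (first_unit (2 * length ds + l)) = \<delta>s ! 0"
  using assms by (cases \<delta>s) (auto simp: bdry_chain_def first_unit_def)

lemma divisor_chain_Cons:
  "divisor_chain (d # ds) \<longleftrightarrow> (ds \<noteq> [] \<longrightarrow> d dvd ds ! 0) \<and> divisor_chain ds"
  by (auto simp: divisor_chain_def less_Suc_eq_0_disj nth_Cons split: nat.splits)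

text \<open>
  Induction on the number of planes, with the induction hypothesis used twice: before the
  transvection, so that one vector \<open>u\<close> of the complement has a boundary value that divides all others
  and pairs to the first elementary divisor of the complement; and after it, since the
  transvection changes the boundary on the complement.
\<close>

lemma bdry_normal_form:
  fixes \<beta> :: "(nat \<Rightarrow> 'r::pid) \<Rightarrow> 'r"
  assumes "divisor_chain ds" "functional (2 * length ds + l) \<beta>"
  shows "\<exists>\<delta>s. bdry_chain ds l \<delta>s \<and>
    formed_space_iso (standard_space ds l \<beta>) (standard_space ds l (normal_bdry \<delta>s))"
  using assms
proof (induction ds arbitrary: \<beta>)
  case Nil
  then obtain \<delta> where "l = 0 \<longrightarrow> \<delta> = 0"
    "formed_space_iso (standard_space [] l \<beta>) (standard_space [] l (normal_bdry [\<delta>]))"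
    using isotropic_normal_form[of l \<beta>] by auto
  then show ?case by (intro exI[of _ "[\<delta>]"]) (simp add: bdry_chain_def del: normal_bdry_Cons)
next
  case (Cons d ds)
  let ?n = "2 * length ds + l"
  let ?u = "first_unit ?n :: nat \<Rightarrow> 'r"
  have ds: "divisor_chain ds" using Cons.prems by (simp add: divisor_chain_Cons)
  have \<beta>: "functional (Suc (Suc ?n)) \<beta>" using Cons.prems by simp
  obtain a \<beta>1 where \<beta>1: "functional (Suc ?n) \<beta>1"
    "\<And>x. x \<in> vec (Suc (Suc ?n)) \<Longrightarrow> \<beta> x = a * x 0 + \<beta>1 (vtl x)"
    using functional_vcons[OF \<beta>] by metis
  obtain b \<beta>2 where \<beta>2: "functional ?n \<beta>2"
    "\<And>x. x \<in> vec (Suc ?n) \<Longrightarrow> \<beta>1 x = b * x 0 + \<beta>2 (vtl x)"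
    using functional_vcons[OF \<beta>1(1)] by metis
  obtain \<delta>s where \<delta>s: "bdry_chain ds l \<delta>s"
    and iso: "formed_space_iso (standard_space ds l \<beta>2) (standard_space ds l (normal_bdry \<delta>s))"
    using Cons.IH[OF ds \<beta>2(1)] by blast
  have "d dvd (ds @ [0]) ! 0" using Cons.prems by (cases ds) (simp_all add: divisor_chain_Cons)
  then obtain t where t: "(ds @ [0]) ! 0 = d * t" by (auto elim: dvdE)
  define \<phi> where "\<phi> x = (if ds = [] then 0 else t * x (Suc 0))" for x
  have \<phi>: "functional ?n \<phi>"
    by (simp add: functional_def linear_on_def \<phi>_def algebra_simps)
  have \<phi>u: "d * \<phi> x = pairing ds ?u x" for x
  proof (cases ds)
    case (Cons d2 ds')
    then show ?thesis using t by (simp add: \<phi>_def first_unit_def mult.assoc)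
  qed (simp add: \<phi>_def)
  have \<phi>u_0: "\<phi> ?u = 0" by (simp add: \<phi>_def first_unit_def)
  obtain h g s r where h: "h dvd g" "h dvd \<delta>s ! 0" "h = s * g + r * \<delta>s ! 0"
    and iso2: "formed_space_iso
      (standard_space (d # ds) l (\<lambda>x. a * x 0 + b * x (Suc 0) + \<beta>2 (vtl (vtl x))))
      (standard_space (d # ds) l (\<lambda>x. h * x 0 + (g * \<phi> (vtl (vtl x)) + normal_bdry \<delta>s (vtl (vtl x)))))"
    by (rule iso_gather[OF iso normal_bdry_functional \<phi>, of ?u d a b])
       (auto simp: \<phi>u \<phi>u_0 normal_bdry_first_unit[OF \<delta>s])
  define \<beta>3 where "\<beta>3 x = g * \<phi> x + normal_bdry \<delta>s x" for x
  have \<beta>3: "functional ?n \<beta>3"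
    by (simp add: functional_def linear_on_def \<beta>3_def normal_bdry_linear \<phi>_def algebra_simps)
  obtain \<epsilon>s where \<epsilon>s: "bdry_chain ds l \<epsilon>s"
    and iso3: "formed_space_iso (standard_space ds l \<beta>3) (standard_space ds l (normal_bdry \<epsilon>s))"
    using Cons.IH[OF ds \<beta>3] by blast
  obtain T where T: "bij_betw T (vec ?n) (vec ?n)" "\<And>x. x \<in> vec ?n \<Longrightarrow> normal_bdry \<epsilon>s (T x) = \<beta>3 x"
    using iso3 by (auto simp: formed_space_iso_def is_isometry_def)
  \<comment> \<open>\<open>\<epsilon>s ! 0\<close> generates the image of \<open>\<beta>3\<close>. The image consists of multiples of \<open>h\<close>, and it contains
    \<open>t * g\<close> and \<open>\<delta>s ! 0\<close>, hence also \<open>t * h\<close>.\<close>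
  have h_dvd: "h dvd \<epsilon>s ! 0"
  proof -
    have "?u \<in> T ` vec ?n" using T(1) by (simp add: bij_betw_def)
    then obtain x where "x \<in> vec ?n" "T x = ?u" by auto
    then have "\<epsilon>s ! 0 = \<beta>3 x" using T(2)[of x] normal_bdry_first_unit[OF \<epsilon>s] by simp
    then show ?thesis using h dvd_normal_bdry[OF \<delta>s] by (simp add: \<beta>3_def)
  qed
  have dvd_h: "d * \<epsilon>s ! 0 dvd (ds @ [0]) ! 0 * h"
  proof (cases ds)
    case (Cons d2 ds')
    have "\<epsilon>s ! 0 dvd \<beta>3 x" if "x \<in> vec ?n" for x
      using dvd_normal_bdry[OF \<epsilon>s dvd_refl, of "T x"] T(2)[OF that] by simp
    note this[of ?u] this[of "vcons 0 (vcons 1 0)"]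
    moreover have "\<beta>3 ?u = \<delta>s ! 0"
      using \<phi>u_0 normal_bdry_first_unit[OF \<delta>s] by (simp add: \<beta>3_def)
    moreover have "\<beta>3 (vcons 0 (vcons 1 0)) = t * g"
      using Cons \<delta>s by (cases \<delta>s) (simp_all add: \<beta>3_def \<phi>_def bdry_chain_def mult.commute)
    ultimately have "\<epsilon>s ! 0 dvd t * g" "\<epsilon>s ! 0 dvd \<delta>s ! 0"
      using Cons by simp_all
    then have "\<epsilon>s ! 0 dvd s * (t * g) + (t * r) * \<delta>s ! 0"
      by (intro dvd_add) (rule dvd_mult, assumption)+
    also have "s * (t * g) + (t * r) * \<delta>s ! 0 = t * h" using h(3) by (simp add: algebra_simps)
    finally show ?thesis unfolding t mult.assoc by (intro mult_dvd_mono) simp_all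
  qed simp
  have "formed_space_iso (standard_space (d # ds) l \<beta>)
      (standard_space (d # ds) l (\<lambda>x. a * x 0 + b * x (Suc 0) + \<beta>2 (vtl (vtl x))))"
    by (rule iso_bdry_cong) (simp add: \<beta>1 \<beta>2)
  also note iso2
  also have "formed_space_iso
      (standard_space (d # ds) l (\<lambda>x. h * x 0 + (g * \<phi> (vtl (vtl x)) + normal_bdry \<delta>s (vtl (vtl x)))))
      (standard_space (d # ds) l (normal_bdry (h # \<epsilon>s)))"
  proof -
    have "normal_bdry (h # \<epsilon>s) = (\<lambda>x. h * x 0 + normal_bdry \<epsilon>s (vtl (vtl x)))"
      by (simp add: fun_eq_iff)
    then show ?thesis
      using iso_plane[OF iso3, of d d 1 1 0 0 1 h h 0 0] by (simp add: \<beta>3_def)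
  qed
  finally show ?case
    using h_dvd dvd_h \<epsilon>s by (intro exI[of _ "h # \<epsilon>s"]) (simp add: bdry_chain_Cons del: normal_bdry_Cons)
qed

section \<open>Form data of the normal forms\<close>

definition axis :: "nat \<Rightarrow> nat \<Rightarrow> 'r::comm_ring_1" where
  "axis k i = (if i = k then 1 else 0)"

lemma axis_vec [simp]: "axis k \<in> vec n \<longleftrightarrow> k < n"
  by (auto simp: vec_def axis_def not_le[symmetric])

lemma pairing_axis:
  assumes "j < length ds"
  shows "pairing ds x (axis (2 * j + 1)) = ds ! j * x (2 * j)"
    and "pairing ds x (axis (2 * j)) = - (ds ! j * x (2 * j + 1))"
proof -
  have parity: "2 * i \<noteq> Suc (2 * i')" "Suc (2 * i') \<noteq> 2 * i" for i i' :: nat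
    by presburger+
  have "pairing ds x (axis (2 * j + 1)) = (\<Sum>i<length ds. if i = j then ds ! j * x (2 * j) else 0)"
    unfolding pairing_def by (intro sum.cong) (auto simp: axis_def parity)
  then show "pairing ds x (axis (2 * j + 1)) = ds ! j * x (2 * j)" using assms by simp
  have "pairing ds x (axis (2 * j)) = (\<Sum>i<length ds. if i = j then - (ds ! j * x (2 * j + 1)) else 0)"
    unfolding pairing_def by (intro sum.cong) (auto simp: axis_def parity)
  then show "pairing ds x (axis (2 * j)) = - (ds ! j * x (2 * j + 1))" using assms by simp
qed

lemma normal_bdry_axis:
  assumes "j < length \<delta>s"
  shows "normal_bdry \<delta>s (axis (2 * j)) = \<delta>s ! j"
proof -
  have "normal_bdry \<delta>s (axis (2 * j)) = (\<Sum>i<length \<delta>s. if i = j then \<delta>s ! j else 0)"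
    unfolding normal_bdry_def by (intro sum.cong) (auto simp: axis_def)
  then show ?thesis using assms by simp
qed

text \<open>
  The product of the relations \<open>\<delta>\<^sub>m\<^sub>+\<^sub>1 | (d\<^sub>m\<^sub>+\<^sub>1 / d\<^sub>m) \<delta>\<^sub>m\<close> for \<open>j \<le> m < i\<close>, where the quotients telescope.
\<close>

lemma bdry_chain_cross:
  fixes ds :: "'r::idom list"
  assumes \<delta>s: "bdry_chain ds l \<delta>s" and nz: "0 \<notin> set ds" and "j \<le> i" "i < length ds"
  shows "ds ! j * \<delta>s ! i dvd ds ! i * \<delta>s ! j"
  using assms(3,4)
proof (induction rule: dec_induct)
  case (step m)
  have rel: "ds ! m * \<delta>s ! Suc m dvd ds ! Suc m * \<delta>s ! m"
  proof -
    have "ds ! m * \<delta>s ! Suc m dvd (ds @ [0]) ! Suc m * \<delta>s ! m"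
      using \<delta>s Suc_lessD[OF step.prems] unfolding bdry_chain_def by blast
    then show ?thesis using step.prems by (simp add: nth_append)
  qed
  have "ds ! m * (ds ! j * \<delta>s ! Suc m) = ds ! j * (ds ! m * \<delta>s ! Suc m)" by (simp add: mult.left_commute)
  also have "\<dots> dvd ds ! j * (ds ! Suc m * \<delta>s ! m)"
    by (rule mult_dvd_mono[OF dvd_refl rel])
  also have "\<dots> = ds ! Suc m * (ds ! j * \<delta>s ! m)" by (simp add: mult.left_commute)
  also have "\<dots> dvd ds ! Suc m * (ds ! m * \<delta>s ! j)"
    by (rule mult_dvd_mono[OF dvd_refl step.IH]) (use step.prems in simp)
  also have "\<dots> = ds ! m * (ds ! Suc m * \<delta>s ! j)" by (simp add: mult.left_commute)
  finally have "ds ! m * (ds ! j * \<delta>s ! Suc m) dvd ds ! m * (ds ! Suc m * \<delta>s ! j)" .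
  moreover have "ds ! m \<noteq> 0" using nz step nth_mem[of m ds] by force
  ultimately show ?case by simp
qed simp

text \<open>
  A vector \<open>x\<close> of \<open>M\<^sub>i\<close> contributes \<open>\<delta>\<^sub>j x\<^sub>2\<^sub>j\<close> to the boundary. For \<open>j \<ge> i\<close> this is a multiple of \<open>\<delta>\<^sub>i\<close> since
  \<open>\<delta>\<^sub>i | \<delta>\<^sub>j\<close>; for \<open>j < i\<close>, membership in \<open>M\<^sub>i\<close> forces \<open>(d\<^sub>i / d\<^sub>j) | x\<^sub>2\<^sub>j\<close>, and \<open>\<delta>\<^sub>i | (d\<^sub>i / d\<^sub>j) \<delta>\<^sub>j\<close>. The value
  \<open>\<delta>\<^sub>i\<close> is attained at the first basis vector of the \<open>i\<close>-th plane.
\<close>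

lemma normal_bdry_image:
  fixes ds :: "'r::idom list"
  defines "S l \<delta>s \<equiv> standard_space ds l (normal_bdry \<delta>s)"
  assumes \<delta>s: "bdry_chain ds l \<delta>s" and ds: "divisor_chain ds" and nz: "0 \<notin> set ds"
  shows "i < length ds \<Longrightarrow> normal_bdry \<delta>s ` div_submodule (S l \<delta>s) (ds ! i) = range ((*) (\<delta>s ! i))"
    and "normal_bdry \<delta>s ` radical (S l \<delta>s) = range ((*) (\<delta>s ! length ds))"
proof -
  let ?k = "length ds"
  have len: "length \<delta>s = Suc ?k" using \<delta>s by (simp add: bdry_chain_def)
  have dz: "ds ! j \<noteq> 0" if "j < ?k" for j using nz that by (metis nth_mem)
  have range_iff: "x \<in> range ((*) a) \<longleftrightarrow> a dvd x" for a x :: 'r by (auto simp: dvd_def)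
  have in_range: "normal_bdry \<delta>s ` X = range ((*) c)"
    if "\<And>x. x \<in> X \<Longrightarrow> c dvd normal_bdry \<delta>s x" "u \<in> X" "normal_bdry \<delta>s u = c"
      "\<And>a. vscale a u \<in> X" for X u c
  proof
    show "normal_bdry \<delta>s ` X \<subseteq> range ((*) c)" using that(1) range_iff by blast
    show "range ((*) c) \<subseteq> normal_bdry \<delta>s ` X"
    proof clarify
      fix a
      have "c * a = normal_bdry \<delta>s (vscale a u)" by (simp add: normal_bdry_linear that(3))
      then show "c * a \<in> normal_bdry \<delta>s ` X" using that(4) by blast
    qed
  qed
  show "normal_bdry \<delta>s ` div_submodule (S l \<delta>s) (ds ! i) = range ((*) (\<delta>s ! i))" if i: "i < ?k"
  proof (rule in_range)
    fix x assume x: "x \<in> div_submodule (S l \<delta>s) (ds ! i)"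
    have "\<delta>s ! i dvd \<delta>s ! j * x (2 * j)" if j: "j < length \<delta>s" for j
    proof (cases "i \<le> j")
      case True
      then show ?thesis using bdry_chain_mono[OF \<delta>s True] j len by simp
    next
      case False
      then have jk: "j < ?k" using i by simp
      then have "ds ! i dvd pairing ds x (axis (2 * j + 1))"
        using x by (simp add: div_submodule_def S_def)
      then have "ds ! i dvd ds ! j * x (2 * j)" unfolding pairing_axis(1)[OF jk] .
      then have "ds ! i * \<delta>s ! j dvd (ds ! j * x (2 * j)) * \<delta>s ! j" by (rule mult_dvd_mono) simp
      moreover have "ds ! j * \<delta>s ! i dvd ds ! i * \<delta>s ! j"
        using bdry_chain_cross[OF \<delta>s nz _ i] False by simp
      ultimately have "ds ! j * \<delta>s ! i dvd (ds ! j * x (2 * j)) * \<delta>s ! j"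
        by (rule dvd_trans[rotated])
      also have "\<dots> = ds ! j * (\<delta>s ! j * x (2 * j))" by (simp add: ac_simps)
      finally have "ds ! j * \<delta>s ! i dvd ds ! j * (\<delta>s ! j * x (2 * j))" .
      then show ?thesis using dz[OF jk] by simp
    qed
    then show "\<delta>s ! i dvd normal_bdry \<delta>s x" unfolding normal_bdry_def by (intro dvd_sum) simp
  next
    have "ds ! i dvd pairing ds (axis (2 * i)) y" for y
      unfolding pairing_swap[of ds _ y] pairing_axis(2)[OF i] by simp
    then show "axis (2 * i) \<in> div_submodule (S l \<delta>s) (ds ! i)"
      "\<And>a. vscale a (axis (2 * i)) \<in> div_submodule (S l \<delta>s) (ds ! i)"
      using i by (auto simp: div_submodule_def S_def pairing_linear)
  qed (use i len in \<open>simp add: normal_bdry_axis\<close>)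
  define u :: "nat \<Rightarrow> 'r" where "u = (if l = 0 then 0 else axis (2 * ?k))"
  show "normal_bdry \<delta>s ` radical (S l \<delta>s) = range ((*) (\<delta>s ! ?k))"
  proof (rule in_range)
    fix x assume x: "x \<in> radical (S l \<delta>s)"
    have "x (2 * j) = 0" if j: "j < ?k" for j
    proof -
      have "pairing ds x (axis (2 * j + 1)) = 0" using x j by (simp add: radical_def S_def)
      then show ?thesis using dz[OF j] unfolding pairing_axis(1)[OF j] by simp
    qed
    then have "normal_bdry \<delta>s x = \<delta>s ! ?k * x (2 * ?k)"
      unfolding normal_bdry_def len by simp
    then show "\<delta>s ! ?k dvd normal_bdry \<delta>s x" by simp
  next
    have "pairing ds u y = 0" for y
      by (auto simp: u_def pairing_def axis_def intro!: sum.neutral)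
    moreover have "u \<in> vec (2 * ?k + l)" by (simp add: u_def)
    ultimately show "u \<in> radical (S l \<delta>s)" "\<And>a. vscale a u \<in> radical (S l \<delta>s)"
      by (auto simp: radical_def S_def pairing_linear)
    show "normal_bdry \<delta>s u = \<delta>s ! ?k"
      using \<delta>s len by (auto simp: u_def normal_bdry_axis bdry_chain_def)
  qed
qed

lemma has_rank_coordinates:
  fixes V :: "('r::comm_ring_1, 'm::ab_group_add, 'z) formed_module_scheme"
  assumes "module (mscale V)" "module.subspace (mscale V) (mcarrier V)"
    and bij: "bij_betw f (mcarrier V) (vec n)" and lin: "linear_on (mscale V) vscale (mcarrier V) f"
  shows "has_rank V n"
proof -
  interpret module "mscale V" by fact
  let ?M = "mcarrier V"
  have sub: "subspace ?M" by fact
  have inj: "inj_on f ?M" and im: "f ` ?M = vec n" using bij by (auto simp: bij_betw_def)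
  have f_add: "f (x + y) = f x + f y" if "x \<in> ?M" "y \<in> ?M" for x y
    using lin that by (simp add: linear_on_def)
  have f_scale: "f (mscale V a x) = vscale a (f x)" if "x \<in> ?M" for a x
    using lin that by (simp add: linear_on_def)
  have "f 0 + f 0 = f 0" using f_add[of 0 0] subspace_0[OF sub] by simp
  then have f0: "f 0 = 0" by simp
  have "\<exists>x\<in>?M. f x = axis i" if "i < n" for i
  proof -
    have "axis i \<in> f ` ?M" using that unfolding im by simp
    then show ?thesis by auto
  qed
  then obtain b where b: "\<And>i. i < n \<Longrightarrow> b i \<in> ?M" "\<And>i. i < n \<Longrightarrow> f (b i) = axis i" by metis
  have b_inj: "inj_on b {..<n}"
  proof (rule inj_onI)
    fix i j assume "i \<in> {..<n}" "j \<in> {..<n}" "b i = b j"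
    then have "axis i i = (axis j i :: 'r)" using b(2) by (metis lessThan_iff)
    then show "i = j" by (simp add: axis_def split: if_splits)
  qed
  have f_sum: "f (\<Sum>i<m. mscale V (c i) (b i)) = (\<lambda>i. if i < m then c i else 0)" if "m \<le> n" for c m
    using that
  proof (induction m)
    case 0
    then show ?case by (simp add: f0 fun_eq_iff)
  next
    case (Suc m)
    have "(\<Sum>i<m. mscale V (c i) (b i)) \<in> ?M"
      using Suc.prems b(1) by (intro subspace_sum[OF sub] subspace_scale[OF sub]) simp
    then show ?case
      using Suc b[of m] subspace_scale[OF sub b(1)[of m]]
      by (auto simp: f_add f_scale fun_eq_iff axis_def less_Suc_eq)
  qed
  let ?B = "b ` {..<n}"
  have sum_B: "(\<Sum>v\<in>?B. mscale V (c v) v) = (\<Sum>i<n. mscale V (c (b i)) (b i))" for c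
    by (simp add: sum.reindex[OF b_inj])
  have "\<not> dependent ?B"
  proof
    assume "dependent ?B"
    then obtain c where c: "\<exists>v\<in>?B. c v \<noteq> 0" "(\<Sum>v\<in>?B. mscale V (c v) v) = 0"
      using dependent_finite[of ?B] by auto
    have "(\<lambda>i. if i < n then c (b i) else 0) = 0"
      using f_sum[of n "\<lambda>i. c (b i)"] f0 c(2) unfolding sum_B by simp
    then have "c (b i) = 0" if "i < n" for i using that fun_cong[of _ 0 i] by fastforce
    then show False using c(1) by auto
  qed
  moreover have "span ?B = ?M"
  proof
    show "span ?B \<subseteq> ?M" using b(1) by (intro span_minimal sub) auto
    show "?M \<subseteq> span ?B"
    proof
      fix x assume x: "x \<in> ?M"
      let ?y = "\<Sum>i<n. mscale V (f x i) (b i)"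
      have "f x \<in> vec n" using x im by auto
      then have "f ?y = f x" unfolding f_sum[OF order_refl] by (auto simp: vec_def fun_eq_iff)
      moreover have "?y \<in> ?M" using b(1) by (intro subspace_sum[OF sub] subspace_scale[OF sub]) simp
      ultimately have "x = ?y" using inj x by (auto dest: inj_onD)
      also have "\<dots> \<in> span ?B" by (intro span_sum span_scale span_base) auto
      finally show "x \<in> span ?B" .
    qed
  qed
  moreover have "card ?B = n" by (simp add: card_image[OF b_inj])
  ultimately show ?thesis unfolding has_rank_def by (intro exI[of _ ?B]) simp
qed

lemma has_rank_isometry:
  fixes V :: "('r::comm_ring_1, 'm::ab_group_add, 'z) formed_module_scheme"
  assumes "is_formed_module V" "is_isometry V (standard_form ds l) f"
  shows "has_rank V (2 * length ds + l)"
  using assms by (intro has_rank_coordinates[of V f]) (auto simp: is_formed_module_def is_isometry_def)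

lemma module_vscale: "module (vscale :: 'r::comm_ring_1 \<Rightarrow> _)"
  by unfold_locales (auto simp: fun_eq_iff algebra_simps)

lemma standard_space_is_formed_space:
  assumes "functional (2 * length ds + l) \<beta>"
  shows "is_formed_space (standard_space ds l \<beta>)"
proof -
  interpret module "vscale :: 'a \<Rightarrow> _" by (rule module_vscale)
  have sub: "subspace (vec n)" for n by (simp add: subspace_def)
  have "has_rank (standard_space ds l \<beta>) (2 * length ds + l)"
    by (rule has_rank_coordinates[of _ id])
       (simp_all add: module_vscale sub linear_on_def)
  then show ?thesis
    using assms module_vscale sub
    by (auto simp: is_formed_space_def is_formed_module_def functional_def linear_on_def pairing_linear)
qed

lemma iso_rescale:
  fixes ds ds' \<delta>s \<delta>s' :: "'r::comm_ring_1 list"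
  assumes "list_all2 (\<lambda>d d'. \<exists>u. u dvd 1 \<and> d = u * d') ds ds'"
    and "list_all2 (\<lambda>d d'. \<exists>u. u dvd 1 \<and> d = u * d') \<delta>s \<delta>s'"
    and "length \<delta>s = Suc (length ds)"
  shows "formed_space_iso (standard_space ds l (normal_bdry \<delta>s)) (standard_space ds' l (normal_bdry \<delta>s'))"
  using assms
proof (induction ds ds' arbitrary: \<delta>s \<delta>s' rule: list_all2_induct)
  case Nil
  then obtain \<delta> \<delta>' v where \<delta>: "\<delta>s = [\<delta>]" "\<delta>s' = [\<delta>']" "v dvd 1" "\<delta> = v * \<delta>'"
    by (auto simp: length_Suc_conv list_all2_Cons1)
  obtain v' where v': "v * v' = 1" using \<delta>(3) by (metis dvdE)
  have "vscale v (vscale v' x) = x" "vscale v' (vscale v x) = x" for x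
    using v' by (simp_all add: fun_eq_iff mult.assoc[symmetric] mult.commute[of v' v])
  then show ?case
    by (intro formed_space_iso_standardI[where T = "vscale v" and T' = "vscale v'"])
       (auto simp: \<delta> fun_eq_iff algebra_simps)
next
  case (Cons d ds d' ds')
  obtain \<delta> \<delta>1 where \<delta>1: "\<delta>s = \<delta> # \<delta>1" "length \<delta>1 = Suc (length ds)"
    using Cons.prems(2) by (cases \<delta>s) simp_all
  obtain \<delta>' \<delta>1' where \<delta>1': "\<delta>s' = \<delta>' # \<delta>1'" "\<exists>v. v dvd 1 \<and> \<delta> = v * \<delta>'"
    and tl: "list_all2 (\<lambda>d d'. \<exists>u. u dvd 1 \<and> d = u * d') \<delta>1 \<delta>1'"
    using Cons.prems(1) unfolding \<delta>1(1) by (cases \<delta>s') simp_all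
  obtain v where v: "v dvd 1" "\<delta> = v * \<delta>'" using \<delta>1'(2) by blast
  obtain u u' where u: "u * u' = 1" "d = u * d'" using Cons.hyps by (metis dvdE)
  obtain v' where v': "v * v' = 1" using v(1) by (metis dvdE)
  have det: "v * (v' * u) - 0 * 0 = u" using v' by (simp add: mult.assoc[symmetric])
  have bdry: "normal_bdry (\<epsilon> # \<epsilon>s) = (\<lambda>x. \<epsilon> * x 0 + 0 * x (Suc 0) + normal_bdry \<epsilon>s (vtl (vtl x)))"
    for \<epsilon> :: 'r and \<epsilon>s
    by (simp add: fun_eq_iff)
  show ?case
    unfolding \<delta>1(1) \<delta>1'(1) bdry
    by (rule iso_plane[OF Cons.IH[OF tl \<delta>1(2)], of d d' v "v' * u" 0 0 u'], unfold det)
       (use u in \<open>simp_all add: v(2) mult.commute\<close>)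
qed

lemma range_mult_eq_iff:
  fixes a b :: "'r::idom"
  assumes "range ((*) a) = range ((*) b)"
  shows "\<exists>v. v dvd 1 \<and> a = v * b"
proof -
  have "a * 1 \<in> range ((*) b)" "b * 1 \<in> range ((*) a)" using assms by blast+
  then obtain v w where "a * 1 = b * v" "b * 1 = a * w" by (elim rangeE)
  then have v: "a = b * v" and w: "b = a * w" by simp_all
  show ?thesis
  proof (cases "b = 0")
    case True
    then show ?thesis using v by (intro exI[of _ 1]) simp
  next
    case False
    have "b * (v * w) = b * 1" using v w by (simp add: mult.assoc[symmetric])
    then have "v * w = 1" using False by simp
    then have "v dvd 1" by (metis dvd_triv_left)
    then show ?thesis using v by (auto simp: mult.commute)
  qed
qed

lemma bdry_image_iso:
  assumes "formed_space_iso V W"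
  shows "bdry V ` div_submodule V d = bdry W ` div_submodule W d"
    and "bdry V ` radical V = bdry W ` radical W"
proof -
  obtain f where im: "f ` mcarrier V = mcarrier W"
    and form: "\<And>x y. x \<in> mcarrier V \<Longrightarrow> y \<in> mcarrier V \<Longrightarrow> form W (f x) (f y) = form V x y"
    and bdry: "\<And>x. x \<in> mcarrier V \<Longrightarrow> bdry W (f x) = bdry V x"
    using assms by (auto simp: formed_space_iso_def is_isometry_def bij_betw_def)
  have img: "bdry V ` D = bdry W ` f ` D" if "D \<subseteq> mcarrier V" for D
    using that bdry unfolding image_image by (intro image_cong) auto
  have "div_submodule W d = f ` div_submodule V d"
    unfolding div_submodule_def im[symmetric] using form by auto
  then show "bdry V ` div_submodule V d = bdry W ` div_submodule W d"
    by (simp only:) (rule img, simp add: div_submodule_def)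
  have "radical W = f ` radical V"
    unfolding radical_def im[symmetric] using form by auto
  then show "bdry V ` radical V = bdry W ` radical W"
    by (simp only:) (rule img, simp add: radical_def)
qed

section \<open>The normal form of an alternating form\<close>

text \<open>
  Formed modules without the requirement of a basis. Orthogonal complements are of this kind at
  once, while their freeness is a consequence of the normal form.
\<close>

locale alternating_module = module "mscale V"
  for V :: "('r::comm_ring_1, 'm::ab_group_add, 'z) formed_module_scheme" +
  assumes sub: "subspace (mcarrier V)"
    and form_left: "y \<in> mcarrier V \<Longrightarrow> linear_on (mscale V) (*) (mcarrier V) (\<lambda>x. form V x y)"
    and form_right: "x \<in> mcarrier V \<Longrightarrow> linear_on (mscale V) (*) (mcarrier V) (\<lambda>y. form V x y)"
    and form_self: "x \<in> mcarrier V \<Longrightarrow> form V x x = 0"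
begin

lemma form_add [simp]:
  "x \<in> mcarrier V \<Longrightarrow> y \<in> mcarrier V \<Longrightarrow> z \<in> mcarrier V \<Longrightarrow> form V (x + y) z = form V x z + form V y z"
  "x \<in> mcarrier V \<Longrightarrow> y \<in> mcarrier V \<Longrightarrow> z \<in> mcarrier V \<Longrightarrow> form V z (x + y) = form V z x + form V z y"
  using form_left[of z] form_right[of z] by (simp_all add: linear_on_def)

lemma form_scale [simp]:
  "x \<in> mcarrier V \<Longrightarrow> z \<in> mcarrier V \<Longrightarrow> form V (mscale V a x) z = a * form V x z"
  "x \<in> mcarrier V \<Longrightarrow> z \<in> mcarrier V \<Longrightarrow> form V z (mscale V a x) = a * form V z x"
  using form_left[of z] form_right[of z] by (simp_all add: linear_on_def)

lemma carrier_closed [simp]: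
  "0 \<in> mcarrier V"
  "x \<in> mcarrier V \<Longrightarrow> y \<in> mcarrier V \<Longrightarrow> x + y \<in> mcarrier V"
  "x \<in> mcarrier V \<Longrightarrow> y \<in> mcarrier V \<Longrightarrow> x - y \<in> mcarrier V"
  "x \<in> mcarrier V \<Longrightarrow> mscale V a x \<in> mcarrier V"
  using sub subspace_0 subspace_add subspace_diff subspace_scale by blast+

lemma form_diff [simp]:
  "x \<in> mcarrier V \<Longrightarrow> y \<in> mcarrier V \<Longrightarrow> z \<in> mcarrier V \<Longrightarrow> form V (x - y) z = form V x z - form V y z"
  "x \<in> mcarrier V \<Longrightarrow> y \<in> mcarrier V \<Longrightarrow> z \<in> mcarrier V \<Longrightarrow> form V z (x - y) = form V z x - form V z y"
  using form_add(1)[of "x - y" y z] form_add(2)[of "x - y" y z] by simp_all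

lemma form_zero [simp]:
  "z \<in> mcarrier V \<Longrightarrow> form V 0 z = 0" "z \<in> mcarrier V \<Longrightarrow> form V z 0 = 0"
  using form_diff(1)[of 0 0 z] form_diff(2)[of 0 0 z] by simp_all

lemma form_swap:
  assumes "x \<in> mcarrier V" "y \<in> mcarrier V"
  shows "form V x y = - form V y x"
proof -
  have "form V (x + y) (x + y) = 0" using assms by (intro form_self) simp
  moreover have "form V (x + y) (x + y) = form V x y + form V y x"
    using assms by (simp add: form_self[OF assms(1)] form_self[OF assms(2)])
  ultimately show ?thesis by (simp add: eq_neg_iff_add_eq_0)
qed

lemma submodule:
  assumes "subspace N" "N \<subseteq> mcarrier V"
  shows "alternating_module (V\<lparr>mcarrier := N\<rparr>)"
  using assms form_left form_right form_self module_axioms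
  unfolding alternating_module_def alternating_module_axioms_def linear_on_def
  by (simp add: subset_iff)

end

lemma is_formed_module_iff:
  "is_formed_module V \<longleftrightarrow> alternating_module V \<and> (\<exists>n. has_rank V n)"
  unfolding is_formed_module_def alternating_module_def alternating_module_axioms_def by blast

definition coordinates ::
    "('r::comm_ring_1 \<Rightarrow> 'm::ab_group_add \<Rightarrow> 'm) \<Rightarrow> 'm set \<Rightarrow> nat \<Rightarrow> ('m \<Rightarrow> nat \<Rightarrow> 'r) \<Rightarrow> bool"
  where
  "coordinates s M n h \<longleftrightarrow> bij_betw h M (vec n) \<and> linear_on s vscale M h"

text \<open>
  \<open>M = N \<oplus> R w\<close>, because \<open>q\<close> maps \<open>M\<close> onto \<open>R\<close> with kernel \<open>N\<close> and \<open>w\<close> is a preimage of \<open>1\<close>.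
\<close>

lemma (in module) coordinates_split:
  assumes M: "subspace M" and w: "w \<in> M" and q: "linear_on scale (*) M q" "q w = 1"
    and N: "N = {x \<in> M. q x = 0}" and h: "coordinates scale N n h"
  shows "coordinates scale M (Suc n) (\<lambda>x. vcons (q x) (h (x - scale (q x) w)))"
proof -
  let ?p = "\<lambda>x. x - scale (q x) w" and ?f = "\<lambda>x. vcons (q x) (h (x - scale (q x) w))"
  have q_add: "q (x + y) = q x + q y" if "x \<in> M" "y \<in> M" for x y
    using q that by (simp add: linear_on_def)
  have q_scale: "q (scale a x) = a * q x" if "x \<in> M" for a x
    using q that by (simp add: linear_on_def)
  have h_add: "h (x + y) = h x + h y" if "x \<in> N" "y \<in> N" for x y
    using h that by (simp add: linear_on_def coordinates_def)
  have h_scale: "h (scale a x) = vscale a (h x)" if "x \<in> N" for a x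
    using h that by (simp add: linear_on_def coordinates_def)
  have bij: "bij_betw h N (vec n)" using h by (simp add: coordinates_def)
  note M_closed = subspace_add[OF M] subspace_scale[OF M] subspace_diff[OF M] w
  have pN: "?p x \<in> N" if "x \<in> M" for x
  proof -
    have "q (?p x + scale (q x) w) = q (?p x) + q (scale (q x) w)"
      using that by (intro q_add M_closed)
    then have "q (?p x) = 0" using q(2) by (simp add: q_scale w)
    then show ?thesis using that by (simp add: N M_closed)
  qed
  have "bij_betw ?f M (vec (Suc n))"
  proof (rule bij_betw_byWitness[where f' = "\<lambda>y. scale (y 0) w + inv_into N h (vtl y)"])
    have left: "inv_into N h (h y) = y" if "y \<in> N" for y
      using bij that by (simp add: bij_betw_def)
    have right: "h (inv_into N h y) = y" "inv_into N h y \<in> N" if "y \<in> vec n" for y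
      using bij that by (auto simp: bij_betw_def f_inv_into_f inv_into_into)
    show "\<forall>x\<in>M. scale (?f x 0) w + inv_into N h (vtl (?f x)) = x"
      using left pN by simp
    have q_inv: "q (scale (y 0) w + inv_into N h (vtl y)) = y 0"
      and inv_M: "scale (y 0) w + inv_into N h (vtl y) \<in> M" if "y \<in> vec (Suc n)" for y
      using right(2)[of "vtl y"] that q(2) by (auto simp: N q_add q_scale M_closed)
    show "\<forall>y\<in>vec (Suc n). ?f (scale (y 0) w + inv_into N h (vtl y)) = y"
      using right by (simp add: q_inv)
    show "?f ` M \<subseteq> vec (Suc n)" using pN bij by (auto simp: bij_betw_def)
    show "(\<lambda>y. scale (y 0) w + inv_into N h (vtl y)) ` vec (Suc n) \<subseteq> M" using inv_M by blast
  qed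
  moreover have "linear_on scale vscale M ?f"
    unfolding linear_on_def
  proof (intro conjI ballI allI)
    fix x y assume xy: "x \<in> M" "y \<in> M"
    have "?p (x + y) = ?p x + ?p y" using xy by (simp add: q_add scale_left_distrib)
    then have "h (?p (x + y)) = h (?p x) + h (?p y)" using xy by (simp only: h_add pN)
    then show "?f (x + y) = ?f x + ?f y" using xy by (simp add: q_add)
  next
    fix a x assume x: "x \<in> M"
    have "?p (scale a x) = scale a (?p x)" using x by (simp add: q_scale scale_right_diff_distrib)
    then have "h (?p (scale a x)) = vscale a (h (?p x))" using x by (simp only: h_scale pN)
    then show "?f (scale a x) = vscale a (?f x)" using x by (simp add: q_scale)
  qed
  ultimately show ?thesis by (simp add: coordinates_def)
qed

text \<open>
  The functionals \<open>g i\<close> embed \<open>M\<close> into the free module \<open>R\<^sup>A\<close>. Submodules inherit this property, and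
  the size of \<open>A\<close> is what the inductions below run on.
\<close>

definition separated ::
    "('r::comm_ring_1 \<Rightarrow> 'm::ab_group_add \<Rightarrow> 'm) \<Rightarrow> 'm set \<Rightarrow> 'i set \<Rightarrow> bool" where
  "separated s M A \<longleftrightarrow> (\<exists>g. (\<forall>i\<in>A. linear_on s (*) M (g i)) \<and> (\<forall>x\<in>M. (\<forall>i\<in>A. g i x = 0) \<longrightarrow> x = 0))"

lemma linear_on_subset: "linear_on s t M f \<Longrightarrow> N \<subseteq> M \<Longrightarrow> linear_on s t N f"
  unfolding linear_on_def by blast

lemma linear_image_principal:
  fixes s :: "'r::pid \<Rightarrow> 'm::ab_group_add \<Rightarrow> 'm"
  assumes "module s" "module.subspace s D" and f: "linear_on s (*) D f"
  obtains c where "f ` D = range ((*) c)"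
proof -
  interpret module s by fact
  have D: "subspace D" by fact
  have f_add: "f (x + y) = f x + f y" if "x \<in> D" "y \<in> D" for x y
    using f that by (simp add: linear_on_def)
  have f_scale: "f (s a x) = a * f x" if "x \<in> D" for a x
    using f that by (simp add: linear_on_def)
  have "f 0 = 0" using f_scale[of 0 0] subspace_0[OF D] by simp
  then have "0 \<in> f ` D" using subspace_0[OF D] by force
  moreover have "\<forall>x\<in>f ` D. \<forall>y\<in>f ` D. x + y \<in> f ` D"
    using subspace_add[OF D] by (auto simp: f_add[symmetric])
  moreover have "\<forall>a. \<forall>x\<in>f ` D. a * x \<in> f ` D"
    using subspace_scale[OF D] by (auto simp: f_scale[symmetric])
  ultimately show thesis using principal_ideal[of "f ` D"] that by blast
qed

text \<open>
  The quotient by \<open>c\<close> is linear because \<open>c\<close> can be cancelled.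
\<close>

lemma linear_on_quotient:
  fixes c :: "'r::idom"
  assumes f: "linear_on s (*) M f" and c: "c \<noteq> 0" and dvd: "\<And>x. x \<in> M \<Longrightarrow> c dvd f x"
    and closed: "\<And>x y. x \<in> M \<Longrightarrow> y \<in> M \<Longrightarrow> x + y \<in> M" "\<And>a x. x \<in> M \<Longrightarrow> s a x \<in> M"
  obtains q where "linear_on s (*) M q" "\<And>x. x \<in> M \<Longrightarrow> f x = c * q x"
proof -
  have "\<exists>q. \<forall>x\<in>M. f x = c * q x" using dvd by (intro bchoice) (auto simp: dvd_def)
  then obtain q where q: "\<And>x. x \<in> M \<Longrightarrow> f x = c * q x" by blast
  have "linear_on s (*) M q"
    unfolding linear_on_def
  proof (intro conjI ballI allI)
    fix x y assume xy: "x \<in> M" "y \<in> M"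
    have "f (x + y) = f x + f y" using f xy by (simp add: linear_on_def)
    then have "c * q (x + y) = c * (q x + q y)" using xy closed by (simp add: q distrib_left)
    then show "q (x + y) = q x + q y" using c by simp
  next
    fix a x assume x: "x \<in> M"
    have "f (s a x) = a * f x" using f x by (simp add: linear_on_def)
    then have "c * q (s a x) = c * (a * q x)" using x closed by (simp add: q mult.left_commute)
    then show "q (s a x) = a * q x" using c by simp
  qed
  then show thesis using q by (rule that)
qed

text \<open>
  Submodules of \<open>R\<^sup>A\<close> are free: one coordinate maps the submodule onto a principal ideal, which is
  zero or free of rank one, and the remaining coordinates embed the kernel.
\<close>

lemma separated_coordinates:
  fixes s :: "'r::pid \<Rightarrow> 'm::ab_group_add \<Rightarrow> 'm"
  assumes "module s" "module.subspace s M" "finite A" "separated s M A"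
  shows "\<exists>l h. coordinates s M l h"
  using assms(3,2,4)
proof (induction A arbitrary: M)
  interpret module s by fact
  case empty
  then have "M = {0}" using subspace_0 by (auto simp: separated_def)
  moreover have "vec 0 = {0}" using vec_0 vec_closed(1) by auto
  ultimately have "coordinates s M 0 (\<lambda>x. 0)"
    by (auto simp: coordinates_def linear_on_def bij_betw_def)
  then show ?case by blast
next
  interpret module s by fact
  case (insert a A)
  note M_closed = subspace_0[OF insert.prems(1)] subspace_add[OF insert.prems(1)] subspace_scale[OF insert.prems(1)]
  obtain g where g: "\<And>i. i \<in> insert a A \<Longrightarrow> linear_on s (*) M (g i)"
    and sep: "\<And>x. x \<in> M \<Longrightarrow> (\<forall>i\<in>insert a A. g i x = 0) \<Longrightarrow> x = 0"
    using insert.prems(2) unfolding separated_def by blast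
  have ga: "linear_on s (*) M (g a)" using g by blast
  then have g_add: "g a (x + y) = g a x + g a y" if "x \<in> M" "y \<in> M" for x y
    using that by (simp add: linear_on_def)
  have g_scale: "g a (s c x) = c * g a x" if "x \<in> M" for c x
    using that ga by (simp add: linear_on_def)
  let ?I = "g a ` M"
  obtain c where c: "?I = range ((*) c)"
    by (rule linear_image_principal[OF module_axioms insert.prems(1) ga])
  define N where "N = {x \<in> M. g a x = 0}"
  have N: "subspace N"
    using g_scale[OF M_closed(1), of 0] by (auto simp: N_def subspace_def M_closed g_add g_scale)
  have "separated s N A"
    unfolding separated_def
    using g sep by (intro exI[of _ g]) (auto simp: N_def intro: linear_on_subset)
  from insert.IH[OF N this] obtain l h where h: "coordinates s N l h" by blast
  show ?case
  proof (cases "c = 0")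
    case True
    then have "g a x = 0" if "x \<in> M" for x using c that by auto
    then have "N = M" by (auto simp: N_def)
    then show ?thesis using h by blast
  next
    case False
    have dvd: "c dvd g a x" if "x \<in> M" for x
    proof -
      have "g a x \<in> range ((*) c)" using that unfolding c[symmetric] by blast
      then show ?thesis by auto
    qed
    obtain q where q: "linear_on s (*) M q" "\<And>x. x \<in> M \<Longrightarrow> g a x = c * q x"
      using linear_on_quotient[OF ga False dvd M_closed(2,3)] by metis
    have "c * 1 \<in> ?I" unfolding c by (rule rangeI)
    then obtain w where w: "w \<in> M" "g a w = c" by auto
    then have qw: "q w = 1" using q(2)[of w] False by simp
    have N_eq: "N = {x \<in> M. q x = 0}" unfolding N_def using q(2) False by auto
    show ?thesis by (intro exI) (rule coordinates_split[OF insert.prems(1) w(1) q(1) qw N_eq h])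
  qed
qed

text \<open>
  If \<open>d = \<lambda>(e, f)\<close> generates a maximal ideal among the values of the form, it divides every value
  \<open>\<lambda>(e', y)\<close> with \<open>\<lambda>(e', f) = d\<close>, since the gcd of \<open>d\<close> and \<open>\<lambda>(e', y)\<close> is the value of \<open>\<lambda>(e', _)\<close> at a
  combination of \<open>f\<close> and \<open>y\<close>. In the same way it divides every \<open>\<lambda>(x, f)\<close>, so that a multiple of \<open>e\<close>
  can be added to \<open>x\<close> to produce such an \<open>e'\<close>.
\<close>

lemma minimal_value_dvd:
  fixes V :: "('r::pid, 'm::ab_group_add, 'z) formed_module_scheme"
  assumes V: "alternating_module V"
    and e: "e \<in> mcarrier V" and f: "f \<in> mcarrier V"
    and min: "\<And>x y. x \<in> mcarrier V \<Longrightarrow> y \<in> mcarrier V \<Longrightarrow> form V x y dvd form V e f \<Longrightarrow> form V e f dvd form V x y"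
    and x: "x \<in> mcarrier V" and y: "y \<in> mcarrier V"
  shows "form V e f dvd form V x y"
proof -
  interpret alternating_module V by fact
  let ?d = "form V e f"
  have e_dvd: "?d dvd form V e' y" if e': "e' \<in> mcarrier V" "form V e' f = ?d" and y: "y \<in> mcarrier V" for e' y
  proof -
    obtain g p q where g: "g dvd ?d" "g dvd form V e' y" "g = p * ?d + q * form V e' y"
      using pid_gcd by blast
    have "form V e' (mscale V p f + mscale V q y) = g" using e' y f by (simp add: g(3))
    then have "?d dvd g" using min[of e' "mscale V p f + mscale V q y"] e' y f g(1) by simp
    then show ?thesis using g(2) by (rule dvd_trans)
  qed
  have f_dvd: "?d dvd form V x f"
  proof -
    obtain g p q where g: "g dvd ?d" "g dvd form V x f" "g = p * ?d + q * form V x f"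
      using pid_gcd by blast
    have "form V (mscale V p e + mscale V q x) f = g" using x e f by (simp add: g(3))
    then have "?d dvd g" using min[of "mscale V p e + mscale V q x" f] x e f g(1) by simp
    then show ?thesis using g(2) by (rule dvd_trans)
  qed
  then obtain t where t: "form V x f = ?d * t" by (auto elim: dvdE)
  let ?e = "e + (x - mscale V t e)"
  have "form V ?e f = ?d" using x e f t by (simp add: mult.commute)
  then have "?d dvd form V ?e y" using x y e by (intro e_dvd) simp_all
  moreover have "form V ?e y = form V x y + (1 - t) * form V e y" using x y e by (simp add: algebra_simps)
  moreover have "?d dvd (1 - t) * form V e y" using e_dvd[OF e refl y] by (rule dvd_mult)
  ultimately show ?thesis by (metis dvd_add_left_iff)
qed

text \<open>
  A pair \<open>e, f\<close> whose value \<open>d\<close> is minimal for divisibility divides the whole form, so \<open>M\<close> is the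
  orthogonal sum of the plane spanned by \<open>e, f\<close> and its complement \<open>N\<close>, on which all values are
  multiples of \<open>d\<close>. The induction is on the size of \<open>A\<close>: since the line of \<open>e\<close> meets \<open>N\<close> only in
  zero, one functional fewer suffices to separate the points of \<open>N\<close>.
\<close>

lemma alternating_normal_form:
  fixes V :: "('r::pid, 'm::ab_group_add, 'z) formed_module_scheme"
  assumes "alternating_module V" "finite A" "separated (mscale V) (mcarrier V) A"
  shows "\<exists>ds l h. divisor_chain ds \<and> 0 \<notin> set ds \<and> is_isometry V (standard_form ds l) h"
  using assms(2,1,3)
proof (induction A arbitrary: V rule: finite_psubset_induct)
  case (psubset A)
  interpret alternating_module V by fact
  let ?M = "mcarrier V" and ?s = "mscale V"
  show ?case
  proof (cases "\<forall>x\<in>?M. \<forall>y\<in>?M. form V x y = 0")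
    case True
    obtain l h where "coordinates ?s ?M l h"
      using separated_coordinates[OF module_axioms sub \<open>finite A\<close> psubset.prems(2)] by blast
    then have "is_isometry V (standard_form [] l) h"
      using True by (auto simp: is_isometry_def coordinates_def)
    then show ?thesis by (intro exI[of _ "[]"]) (auto simp: divisor_chain_def)
  next
    case False
    let ?Q = "{form V x y | x y. x \<in> ?M \<and> y \<in> ?M \<and> form V x y \<noteq> 0}"
    obtain d0 where d0: "d0 \<in> ?Q" using False by blast
    obtain d where d: "d \<in> ?Q" and d_min: "\<And>z. (z, d) \<in> {(a, b). a dvd b \<and> \<not> b dvd a} \<Longrightarrow> z \<notin> ?Q"
      by (rule wfE_min[OF pid_wf_strict_dvd d0]) (rule that)
    obtain e f where e: "e \<in> ?M" and f: "f \<in> ?M" and ef: "form V e f = d" and nz: "d \<noteq> 0"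
      using d by blast
    have d_dvd: "d dvd form V x y" if "x \<in> ?M" "y \<in> ?M" for x y
      unfolding ef[symmetric]
    proof (rule minimal_value_dvd[OF alternating_module_axioms e f _ that])
      fix x y assume xy: "x \<in> ?M" "y \<in> ?M" "form V x y dvd form V e f"
      show "form V e f dvd form V x y"
      proof (rule ccontr)
        assume "\<not> form V e f dvd form V x y"
        then have "form V x y \<notin> ?Q" using d_min[of "form V x y"] xy(3) by (simp add: ef)
        then have "form V x y = 0" using xy by blast
        then show False using xy(3) nz by (simp add: ef)
      qed
    qed
    obtain p where p: "linear_on ?s (*) ?M p" "\<And>x. x \<in> ?M \<Longrightarrow> form V x f = d * p x"
      using linear_on_quotient[OF form_left[OF f] nz d_dvd[OF _ f] carrier_closed(2,4)] by metis
    obtain q where q: "linear_on ?s (*) ?M q" "\<And>x. x \<in> ?M \<Longrightarrow> form V e x = d * q x"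
      using linear_on_quotient[OF form_right[OF e] nz d_dvd[OF e] carrier_closed(2,4)] by metis
    define N1 where "N1 = {x \<in> ?M. p x = 0}"
    define N where "N = {x \<in> N1. q x = 0}"
    have lin: "p (x + y) = p x + p y" "q (x + y) = q x + q y" "p (?s a x) = a * p x" "q (?s a x) = a * q x"
      if "x \<in> ?M" "y \<in> ?M" for x y a
      using p(1) q(1) that by (simp_all add: linear_on_def)
    have lin0: "p 0 = 0" "q 0 = 0" using lin(3)[of 0 0 0] lin(4)[of 0 0 0] by simp_all
    have lin_diff: "q (x - y) = q x - q y" if "x \<in> ?M" "y \<in> ?M" for x y
      using lin(2)[of "x - y" y] that by simp
    have vals: "p e = 1" "q f = 1" "p f = 0" "q e = 0"
      using p(2)[OF e] q(2)[OF f] p(2)[OF f] q(2)[OF e] nz form_self[OF e] form_self[OF f] ef by auto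
    have N1_sub: "subspace N1" by (auto simp: N1_def subspace_def lin lin0)
    have N_sub: "subspace N" by (auto simp: N_def N1_def subspace_def lin lin0)
    have NM: "N \<subseteq> ?M" by (auto simp: N_def N1_def)
    let ?N = "V\<lparr>mcarrier := N\<rparr>"
    have alt_N: "alternating_module ?N" by (rule submodule[OF N_sub NM])
    obtain g where g: "\<And>i. i \<in> A \<Longrightarrow> linear_on ?s (*) ?M (g i)"
      and sep: "\<And>x. x \<in> ?M \<Longrightarrow> (\<forall>i\<in>A. g i x = 0) \<Longrightarrow> x = 0"
      using psubset.prems(2) unfolding separated_def by blast
    have g_add: "g i (x + y) = g i x + g i y" if "i \<in> A" "x \<in> ?M" "y \<in> ?M" for i x y
      using g[OF that(1)] that by (simp add: linear_on_def)
    have g_scale: "g i (?s c x) = c * g i x" if "i \<in> A" "x \<in> ?M" for i x c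
      using g[OF that(1)] that by (simp add: linear_on_def)
    have g_diff: "g i (x - y) = g i x - g i y" if "i \<in> A" "x \<in> ?M" "y \<in> ?M" for i x y
      using g_add[of i "x - y" y] that by simp
    have "e \<noteq> 0" using vals(1) lin0 by auto
    then obtain a where a: "a \<in> A" "g a e \<noteq> 0" using sep[OF e] by blast
    \<comment> \<open>Fraction-free elimination: these functionals are the coordinates, up to the factor \<open>g a e\<close>,
      of the projection of \<open>x\<close> along \<open>e\<close> to the kernel of \<open>g a\<close>.\<close>
    have "separated ?s N (A - {a})"
      unfolding separated_def
    proof (intro exI[of _ "\<lambda>i x. g a e * g i x - g a x * g i e"] conjI ballI impI)
      fix i assume "i \<in> A - {a}"
      then show "linear_on ?s (*) N (\<lambda>x. g a e * g i x - g a x * g i e)"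
        using NM a(1) by (auto simp: linear_on_def subset_iff g_add g_scale algebra_simps)
    next
      fix x assume x: "x \<in> N" and zero: "\<forall>i\<in>A - {a}. g a e * g i x - g a x * g i e = 0"
      have xM: "x \<in> ?M" and px: "p x = 0" using x by (auto simp: N_def N1_def)
      have zero': "g a e * g i x = g a x * g i e" if "i \<in> A" for i
        using zero that by (cases "i = a") auto
      let ?z = "?s (g a e) x - ?s (g a x) e"
      have "g i ?z = 0" if "i \<in> A" for i
        using that xM e zero'[OF that] by (simp add: g_diff g_scale)
      then have "?z = 0" using xM e by (intro sep) simp_all
      then have "p (?s (g a e) x) = p (?s (g a x) e)" by simp
      then have "g a x = 0" using xM e lin(3) px vals by simp
      then have "g i x = 0" if "i \<in> A" for i using zero'[OF that] a(2) by simp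
      then show "x = 0" using sep[OF xM] by blast
    qed
    then obtain ds l h where ds: "divisor_chain ds" "0 \<notin> set ds" and h: "is_isometry ?N (standard_form ds l) h"
      using psubset.IH[of "A - {a}" ?N] a(1) alt_N by auto
    define n where "n = 2 * length ds + l"
    have h_coord: "coordinates ?s N n h" using h by (simp add: is_isometry_def coordinates_def n_def)
    define h1 where "h1 x = vcons (q x) (h (x - ?s (q x) f))" for x
    define h2 where "h2 x = vcons (p x) (h1 (x - ?s (p x) e))" for x
    have "coordinates ?s N1 (Suc n) h1"
      unfolding h1_def
      by (rule coordinates_split[OF N1_sub _ linear_on_subset[OF q(1)] vals(2) N_def h_coord])
         (use f vals in \<open>auto simp: N1_def\<close>)
    then have h2: "coordinates ?s ?M (Suc (Suc n)) h2"
      unfolding h2_def by (rule coordinates_split[OF sub e p(1) vals(1) N1_def])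
    define r where "r x = x - ?s (p x) e - ?s (q x) f" for x
    have rM: "r x \<in> ?M" if "x \<in> ?M" for x using that e f by (simp add: r_def)
    have decomp: "x = r x + (?s (p x) e + ?s (q x) f)" for x by (simp add: r_def)
    have r_orth: "form V (r x) e = 0" "form V (r x) f = 0" "form V e (r x) = 0" "form V f (r x) = 0"
      if x: "x \<in> ?M" for x
    proof -
      show 1: "form V (r x) f = 0" using x e f by (simp add: r_def p(2)[OF x] ef form_self mult.commute)
      show 2: "form V e (r x) = 0" using x e f by (simp add: r_def q(2)[OF x] ef form_self mult.commute)
      show "form V (r x) e = 0" "form V f (r x) = 0"
        using form_swap[of "r x" e] form_swap[of f "r x"] 1 2 rM[OF x] e f by simp_all
    qed
    have rN: "r x \<in> N" if x: "x \<in> ?M" for x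
      using r_orth[OF x] rM[OF x] p(2)[OF rM[OF x]] q(2)[OF rM[OF x]] nz by (simp add: N_def N1_def)
    have h2_eq: "h2 x = vcons (p x) (vcons (q x) (h (r x)))" if "x \<in> ?M" for x
      using that e by (simp add: h2_def h1_def r_def lin_diff lin vals)
    have form_h2: "pairing (d # ds) (h2 x) (h2 y) = form V x y" if x: "x \<in> ?M" and y: "y \<in> ?M" for x y
    proof -
      have "form V x y = form V (r x + (?s (p x) e + ?s (q x) f)) (r y + (?s (p y) e + ?s (q y) f))"
        using decomp by metis
      also have "\<dots> = form V (r x) (r y) + d * (p x * q y - q x * p y)"
        using rM[OF x] rM[OF y] e f ef form_swap[OF f e]
        by (simp add: r_orth x y form_self algebra_simps)
      also have "form V (r x) (r y) = pairing ds (h (r x)) (h (r y))"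
        using h rN[OF x] rN[OF y] by (simp add: is_isometry_def)
      finally show ?thesis using x y by (simp add: h2_eq)
    qed
    have "d dvd ds ! 0" if "ds \<noteq> []"
    proof -
      obtain d2 ds' where ds': "ds = d2 # ds'" using \<open>ds \<noteq> []\<close> by (cases ds) auto
      let ?u = "vcons 1 0 :: nat \<Rightarrow> 'r" and ?v = "vcons 0 (vcons 1 0) :: nat \<Rightarrow> 'r"
      have "?u \<in> h ` N" "?v \<in> h ` N"
        using h ds' by (simp_all add: is_isometry_def bij_betw_def)
      then obtain x y where xy: "x \<in> N" "y \<in> N" "h x = ?u" "h y = ?v" by (metis imageE)
      have "pairing ds (h x) (h y) = form V x y"
        using h xy(1,2) by (simp add: is_isometry_def)
      then have "form V x y = pairing ds ?u ?v" unfolding xy(3,4) by (rule sym)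
      also have "\<dots> = d2" by (simp add: ds')
      finally show ?thesis using d_dvd[of x y] xy NM ds' by auto
    qed
    then have "divisor_chain (d # ds)" using ds by (simp add: divisor_chain_Cons)
    moreover have "is_isometry V (standard_form (d # ds) l) h2"
      using h2 form_h2 by (simp add: is_isometry_def coordinates_def n_def)
    ultimately show ?thesis using ds nz by (intro exI[of _ "d # ds"] exI[of _ l] exI[of _ h2]) simp
  qed
qed

lemma separated_if_has_rank:
  fixes V :: "('r::comm_ring_1, 'm::ab_group_add, 'z) formed_module_scheme"
  assumes "module (mscale V)" "has_rank V n"
  obtains A :: "'m set" where "finite A" "separated (mscale V) (mcarrier V) A"
proof -
  interpret module "mscale V" by fact
  obtain B where B: "finite B" "independent B" "span B = mcarrier V"
    using assms(2) unfolding has_rank_def by blast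
  have "separated (mscale V) (mcarrier V) B"
    unfolding separated_def
  proof (intro exI[of _ "\<lambda>b x. representation B x b"] conjI ballI impI)
    fix b show "linear_on (mscale V) (*) (mcarrier V) (\<lambda>x. representation B x b)"
      using B(2,3) by (auto simp: linear_on_def representation_add representation_scale)
  next
    fix x assume x: "x \<in> mcarrier V" "\<forall>b\<in>B. representation B x b = 0"
    have "x = (\<Sum>b\<in>B. mscale V (representation B x b) b)"
      using x(1) B by (intro sum_representation_eq[symmetric]) auto
    also have "\<dots> = 0" using x(2) by (intro sum.neutral) simp
    finally show "x = 0" .
  qed
  then show thesis using that B(1) by blast
qed

section \<open>The classification\<close>

lemma form_data_exists:
  fixes V :: "('r::pid, 'm::ab_group_add) formed_space"
  assumes V: "is_formed_space V" and nz: "mcarrier V \<noteq> {0}"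
  shows "\<exists>D. is_form_data V D"
proof -
  have fm: "is_formed_module V" and bdry: "linear_on (mscale V) (*) (mcarrier V) (bdry V)"
    using V by (simp_all add: is_formed_space_def)
  interpret alternating_module V using fm by (simp add: is_formed_module_iff)
  obtain n where "has_rank V n" using fm by (auto simp: is_formed_module_def)
  then obtain A :: "'m set" where "finite A" "separated (mscale V) (mcarrier V) A"
    by (rule separated_if_has_rank[OF module_axioms])
  then obtain ds l f where ds: "divisor_chain ds" "0 \<notin> set ds" and f: "is_isometry V (standard_form ds l) f"
    using alternating_normal_form[OF alternating_module_axioms] by blast
  have "2 * length ds + l \<noteq> 0"
  proof
    assume "2 * length ds + l = 0"
    then have "bij_betw f (mcarrier V) (vec 0)" using f by (simp add: is_isometry_def)
    then have "f x \<in> vec 0" "inj_on f (mcarrier V)" if "x \<in> mcarrier V" for x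
      using that by (auto simp: bij_betw_def)
    then have "x = 0" if "x \<in> mcarrier V" for x
      using that carrier_closed(1) vec_0 by (metis inj_onD)
    then show False using nz carrier_closed(1) by blast
  qed
  moreover have ideal: "\<exists>c. range ((*) c) = bdry V ` D" if D: "subspace D" "D \<subseteq> mcarrier V" for D
  proof -
    have "linear_on (mscale V) (*) D (bdry V)" by (rule linear_on_subset[OF bdry D(2)])
    then show ?thesis by (metis linear_image_principal module_axioms D(1))
  qed
  have "subspace (div_submodule V d)" for d
    by (auto simp: subspace_def div_submodule_def)
  then have "\<forall>i. \<exists>c. range ((*) c) = bdry V ` div_submodule V (ds ! i)"
    by (intro allI ideal) (auto simp: div_submodule_def)
  then obtain c where c: "\<And>i. range ((*) (c i)) = bdry V ` div_submodule V (ds ! i)" by metis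
  have "subspace (radical V)" by (auto simp: subspace_def radical_def)
  then obtain c' where c': "range ((*) c') = bdry V ` radical V"
    using ideal[of "radical V"] by (auto simp: radical_def)
  have "is_form_data V (2 * length ds + l, l, ds, map c [0..<length ds] @ [c'])"
    using \<open>2 * length ds + l \<noteq> 0\<close> ds f c c' has_rank_isometry[OF fm f]
    by (auto simp: nth_append Suc_le_eq simp del: standard_form_sel)
  then show ?thesis by blast
qed

text \<open>
  Transport the boundary along the given isometry with the standard form, and normalize it there
  without changing \<open>ds\<close>. The resulting \<open>\<epsilon>s\<close> generate the same ideals as the \<open>\<delta>s\<close>, because both are
  boundary images of submodules that only depend on the form.
\<close>

lemma form_data_normal_form:
  fixes V :: "('r::pid, 'm::ab_group_add) formed_space"
  assumes V: "is_formed_space V" and D: "is_form_data V (n, l, ds, \<delta>s)"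
  obtains \<epsilon>s where "formed_space_iso V (standard_space ds l (normal_bdry \<epsilon>s))"
    "length \<epsilon>s = Suc (length ds)"
    "list_all2 (\<lambda>\<delta> \<epsilon>. \<exists>v. v dvd 1 \<and> \<delta> = v * \<epsilon>) \<delta>s \<epsilon>s"
    "list_all2 (\<lambda>\<delta> \<epsilon>. \<exists>v. v dvd 1 \<and> \<delta> = v * \<epsilon>) \<epsilon>s \<delta>s"
proof -
  have fm: "is_formed_module V" and bdry: "linear_on (mscale V) (*) (mcarrier V) (bdry V)"
    using V by (simp_all add: is_formed_space_def)
  obtain f where f: "is_isometry V (standard_form ds l) f" and ds: "divisor_chain ds" "0 \<notin> set ds"
    and len: "length \<delta>s = length ds + 1"
    and \<delta>s: "\<And>i. i < length ds \<Longrightarrow> range ((*) (\<delta>s ! i)) = bdry V ` div_submodule V (ds ! i)"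
      "range ((*) (\<delta>s ! length ds)) = bdry V ` radical V"
    using D by auto
  let ?g = "inv_into (mcarrier V) f"
  let ?n = "2 * length ds + l" and ?\<beta> = "\<lambda>x. bdry V (?g x)"
  have inv: "is_isometry (standard_form ds l) V ?g" by (rule is_isometry_inv[OF fm f])
  then have "?g x \<in> mcarrier V" if "x \<in> vec ?n" for x
    using that by (auto simp: is_isometry_def bij_betw_def)
  then have \<beta>: "functional ?n ?\<beta>"
    using inv bdry by (auto simp: functional_def linear_on_def is_isometry_def)
  have "formed_space_iso V (standard_space ds l ?\<beta>)"
    using f by (auto simp: formed_space_iso_def is_isometry_def bij_betw_def intro!: exI[of _ f])
  moreover obtain \<epsilon>s where \<epsilon>s: "bdry_chain ds l \<epsilon>s"
    and "formed_space_iso (standard_space ds l ?\<beta>) (standard_space ds l (normal_bdry \<epsilon>s))"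
    using bdry_normal_form[OF ds(1) \<beta>] by blast
  ultimately have iso: "formed_space_iso V (standard_space ds l (normal_bdry \<epsilon>s))"
    by (blast intro: formed_space_iso_trans)
  have len': "length \<epsilon>s = Suc (length ds)" using \<epsilon>s by (simp add: bdry_chain_def)
  have range_eq: "range ((*) (\<delta>s ! i)) = range ((*) (\<epsilon>s ! i))" if "i < length \<delta>s" for i
  proof (cases "i < length ds")
    case True
    then show ?thesis
      using \<delta>s(1)[OF True] normal_bdry_image(1)[OF \<epsilon>s ds True] bdry_image_iso(1)[OF iso] by simp
  next
    case False
    then have "i = length ds" using that len by simp
    then show ?thesis
      using \<delta>s(2) normal_bdry_image(2)[OF \<epsilon>s ds] bdry_image_iso(2)[OF iso] by simp
  qed
  show thesis
  proof (rule that[OF iso len'])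
    show "list_all2 (\<lambda>\<delta> \<epsilon>. \<exists>v. v dvd 1 \<and> \<delta> = v * \<epsilon>) \<delta>s \<epsilon>s"
      unfolding list_all2_conv_all_nth using len len' range_mult_eq_iff[OF range_eq] by simp
    show "list_all2 (\<lambda>\<delta> \<epsilon>. \<exists>v. v dvd 1 \<and> \<delta> = v * \<epsilon>) \<epsilon>s \<delta>s"
      unfolding list_all2_conv_all_nth using len len' range_mult_eq_iff[OF range_eq[symmetric]] by simp
  qed
qed

theorem theoremB3:
  fixes V :: "('r::pid, 'm::ab_group_add) formed_space"
    and W :: "('r, 'n::ab_group_add) formed_space"
    and n l :: nat and ds \<delta>s :: "'r list"
  shows "(is_formed_space V \<and> mcarrier V \<noteq> {0} \<and> is_formed_space W \<and> mcarrier W \<noteq> {0} \<and>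
            form_data_class V = form_data_class W
          \<longrightarrow> formed_space_iso V W)
       \<and> (form_data_tuple (n, l, ds, \<delta>s) \<and> form_data_relations (n, l, ds, \<delta>s) \<and>
            (l = 0 \<longrightarrow> \<delta>s ! length ds = 0)
          \<longrightarrow> (\<exists>U :: ('r, nat \<Rightarrow> 'r) formed_space.
                 is_formed_space U \<and> mcarrier U \<noteq> {0} \<and> (n, l, ds, \<delta>s) \<in> form_data_class U))"
proof (intro conjI impI; elim conjE)
  let ?assoc = "\<lambda>a b :: 'r. \<exists>u. u dvd 1 \<and> a = u * b"
  have assoc_refl: "list_all2 ?assoc xs xs" for xs
    by (rule list_all2_refl) (auto intro!: exI[of _ 1])
  have assoc_trans: "list_all2 ?assoc xs zs" if "list_all2 ?assoc xs ys" "list_all2 ?assoc ys zs" for xs ys zs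
  proof (rule list_all2_trans[OF _ that])
    fix a b c :: 'r assume "?assoc a b" "?assoc b c"
    then obtain u v where "u dvd 1" "v dvd 1" "a = (u * v) * c" by (auto simp: mult.assoc)
    then show "?assoc a c" using mult_dvd_mono[of u 1 v 1] by auto
  qed
  have refl: "form_data_equiv D D" for D :: "'r form_data"
    by (cases D) (simp add: assoc_refl)
  {
    assume V: "is_formed_space V" "mcarrier V \<noteq> {0}" and W: "is_formed_space W"
      and eq: "form_data_class V = form_data_class W"
    obtain n l ds \<delta>s where DV: "is_form_data V (n, l, ds, \<delta>s)"
      using form_data_exists[OF V] by (metis prod_cases4)
    have "(n, l, ds, \<delta>s) \<in> form_data_class V"
      unfolding form_data_class_def using DV refl by blast
    then have "(n, l, ds, \<delta>s) \<in> form_data_class W" unfolding eq .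
    then obtain D' where D': "is_form_data W D'" "form_data_equiv (n, l, ds, \<delta>s) D'"
      unfolding form_data_class_def by blast
    obtain ds' \<delta>s' where D'_eq: "D' = (n, l, ds', \<delta>s')"
      using D'(2) by (cases D') simp
    have DW: "is_form_data W (n, l, ds', \<delta>s')" using D'(1) unfolding D'_eq .
    have assoc: "list_all2 ?assoc ds ds'" "list_all2 ?assoc \<delta>s \<delta>s'"
      using D'(2) unfolding D'_eq by simp_all
    obtain \<epsilon>s where \<epsilon>s: "formed_space_iso V (standard_space ds l (normal_bdry \<epsilon>s))"
      "length \<epsilon>s = Suc (length ds)" "list_all2 ?assoc \<epsilon>s \<delta>s"
      by (rule form_data_normal_form[OF V(1) DV])
    obtain \<epsilon>s' where \<epsilon>s': "formed_space_iso W (standard_space ds' l (normal_bdry \<epsilon>s'))"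
      "list_all2 ?assoc \<delta>s' \<epsilon>s'"
      by (rule form_data_normal_form[OF W DW])
    note \<epsilon>s(1)
    also have "formed_space_iso (standard_space ds l (normal_bdry \<epsilon>s)) (standard_space ds' l (normal_bdry \<epsilon>s'))"
      using assoc_trans[OF \<epsilon>s(3) assoc_trans[OF assoc(2) \<epsilon>s'(2)]]
      by (rule iso_rescale[OF assoc(1) _ \<epsilon>s(2)])
    also have "formed_space_iso (standard_space ds' l (normal_bdry \<epsilon>s')) W"
      by (rule formed_space_iso_sym[OF W \<epsilon>s'(1)])
    finally show "formed_space_iso V W" .
  next
    assume tuple: "form_data_tuple (n, l, ds, \<delta>s)" and rel: "form_data_relations (n, l, ds, \<delta>s)"
      and last: "l = 0 \<longrightarrow> \<delta>s ! length ds = 0"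
    have n: "n = 2 * length ds + l" "1 \<le> n" and nz: "0 \<notin> set ds" and len: "length \<delta>s = Suc (length ds)"
      and ds: "divisor_chain ds"
      using tuple rel by auto
    have "ds ! i * \<delta>s ! Suc i dvd (ds @ [0]) ! Suc i * \<delta>s ! i" if i: "i < length ds" for i
    proof -
      have "ds ! i dvd (ds @ [0]) ! Suc i"
        using ds i by (cases "Suc i < length ds") (auto simp: divisor_chain_def nth_append)
      then obtain q where q: "(ds @ [0]) ! Suc i = q * ds ! i" by (metis dvdE mult.commute)
      have "ds ! i \<noteq> 0" using nz i by (metis nth_mem)
      then have "exact_quotient ((ds @ [0]) ! Suc i) (ds ! i) = q"
        unfolding q by (rule exact_quotient_mult)
      then have "\<delta>s ! Suc i dvd q * \<delta>s ! i" using rel i by auto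
      then have "ds ! i * \<delta>s ! Suc i dvd ds ! i * (q * \<delta>s ! i)" by (rule mult_dvd_mono[OF dvd_refl])
      then show ?thesis unfolding q by (simp add: ac_simps)
    qed
    then have chain: "bdry_chain ds l \<delta>s"
      using rel len last by (simp add: bdry_chain_def)
    let ?U = "standard_space ds l (normal_bdry \<delta>s)"
    have U: "is_formed_space ?U"
      by (rule standard_space_is_formed_space[OF normal_bdry_functional])
    have iso: "is_isometry ?U (standard_form ds l) id"
      by (simp add: is_isometry_def linear_on_def)
    have "is_form_data ?U (n, l, ds, \<delta>s)"
      using tuple ds iso normal_bdry_image[OF chain ds nz] has_rank_isometry[OF _ iso] U n(1)
      by (auto simp: is_formed_space_def)
    moreover have "axis 0 \<in> mcarrier ?U" using n by auto
    moreover have "axis 0 \<noteq> (0 :: nat \<Rightarrow> 'r)" by (metis axis_def zero_fun_apply zero_neq_one)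
    ultimately show "\<exists>U :: ('r, nat \<Rightarrow> 'r) formed_space.
        is_formed_space U \<and> mcarrier U \<noteq> {0} \<and> (n, l, ds, \<delta>s) \<in> form_data_class U"
      using U refl unfolding form_data_class_def by blast
  }
qed

end
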